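(* Consider the CreditRisk$^+$ model with random exposures described in the context, with portfolio loss $X=\sum_A\sum_{i=1}^{D_A}\mathcal{E}_{A,i}$ and with the notation $\mathbb{P}_{\alpha'}[X=\cdot\,]$ introduced there, where $\alpha=(\alpha_1,\ldots,\alpha_N)$ is the vector of the actual model parameters. Let $A(1)\neq A(2)$ be two fixed obligors and let $x$ be an integer such that $\mathbb{P}_\alpha[X=x]>0$. Then $$\begin{aligned} \mathbb{E}[D_{A(1)}\,D_{A(2)}\mid X=x] = \frac{p_{A(1)}\,p_{A(2)}}{\mathbb{P}_{\alpha}[X = x]}\Big( & w_{A(1) 0}\,w_{A(2) 0}\,\mathbb{P}_{\alpha}[X = x-\widetilde{\mathcal{E}}_{A(1)}-\widetilde{\mathcal{E}}_{A(2)}] \\ &+ \sum_{j=1}^N \bigl(w_{A(1) 0}\,w_{A(2) j} + w_{A(1) j}\,w_{A(2) 0}\bigr)\,\mathbb{P}_{\alpha + e_j}[X = x - \widetilde{\mathcal{E}}_{A(1)}-\widetilde{\mathcal{E}}_{A(2)}]\\ &+ \sum_{j=1}^N w_{A(1) j}\,w_{A(2) j}\,\frac{\alpha_j+1}{\alpha_j}\,\mathbb{P}_{\alpha + 2 e_j}[X = x - \widetilde{\mathcal{E}}_{A(1)}-\widetilde{\mathcal{E}}_{A(2)}]\\ &+ \sum_{i=1}^N \sum_{j=1,\, j\neq i}^N w_{A(1) i}\,w_{A(2) j}\,\mathbb{P}_{\alpha + e_i + e_j}[X = x - \widetilde{\mathcal{E}}_{A(1)}-\widetilde{\mathcal{E}}_{A(2)}]\Big),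 \end{aligned}$$ where $e_j$ is the $j$-th unit vector of $\mathbb{R}^N$, and $\widetilde{\mathcal{E}}_{A(1)},\widetilde{\mathcal{E}}_{A(2)}$ are random variables with the same distributions as $\mathcal{E}_{A(1)},\mathcal{E}_{A(2)}$, independent of each other and of $X$.
   Context: Model. There is a finite set of obligors $A$ and an integer $N\ge 1$. All random variables live on a common probability space with probability $\mathbb{P}$ and expectation $\mathbb{E}$. (i) $\mathbf{S}=(S_0,S_1,\ldots,S_N)$ with $S_0=1$ constant and $S_1,\ldots,S_N$ independent; for $k\ge 1$, $S_k$ is Gamma-distributed with parameters $(\alpha_k,1/\alpha_k)$, $\alpha_k>0$, where Gamma$(a,b)$ has density $\frac{y^{a-1}}{b^a\Gamma(a)}e^{-y/b}$, $y>0$ (so $\mathbb{E}[S_k]=1$). (ii) Each obligor $A$ has a constant $p_A>0$ and weights $0\le w_{Ak}\le 1$, $k=0,\ldots,N$, with $\sum_{k=0}^N w_{Ak}=1$. The non-negative integer-valued variables $D_A$ are conditionally independent given $\mathbf{S}$, and the conditional distribution of $D_A$ given $\mathbf{S}$ is Poisson with intensity $p_A^S=p_A\sum_{k=0}^N w_{Ak}S_k$. (iii) For each obligor $A$, $\mathcal{E}_A$ is a non-negative integer-valued random variable with generating function $H_A(z)=\mathbb{E}[z^{\mathcal{E}_A}]$, $z\in\mathbb{C}$, $|z|\le 1$, and $\mathcal{E}_{A,1},\mathcal{E}_{A,2},\ldots$ are copies of $\mathcal{E}_A$. All the variables $\mathcal{E}_{A,i}$ (over all $A$ and $i$) are mutually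 independent and independent of $((D_A)_A,\mathbf{S})$. The portfolio loss is $X=\sum_A\sum_{i=1}^{D_A}\mathcal{E}_{A,i}$. Notation. For $k=0,\ldots,N$ put $\mu_k=\sum_A w_{Ak}p_A$ and $\mathcal{Q}_k(z)=\frac1{\mu_k}\sum_A w_{Ak}\,p_A\,H_A(z)$, and for $k=1,\ldots,N$ put $\delta_k=\mu_k/(\mu_k+\alpha_k)$. (If $\mu_k=0$, the products $\mu_k\mathcal{Q}_k$ and $\delta_k\mathcal{Q}_k$ are read as $0$.) For a vector $\alpha'=(\alpha'_1,\ldots,\alpha'_N)$ with positive entries, $\mathbb{P}_{\alpha'}[X=\cdot\,]$ denotes the probability distribution on the non-negative integers with generating function $$\sum_{m=0}^\infty \mathbb{P}_{\alpha'}[X=m]\,z^m = e^{\mu_0(\mathcal{Q}_0(z)-1)}\prod_{k=1}^N\left(\frac{1-\delta_k}{1-\delta_k\mathcal{Q}_k(z)}\right)^{\alpha'_k},$$ where only the exponents depend on $\alpha'$, while $\mu_0$, $\mathcal{Q}_0,\ldots,\mathcal{Q}_N$ and $\delta_1,\ldots,\delta_N$ are kept fixed at the values above computed from the original $\alpha$. For $\alpha'=\alpha=(\alpha_1,\ldots,\alpha_N)$ this is the distribution of $X$ in the model. Moreover, $$\mathbb{P}_{\alpha'}[X = x-\widetilde{\mathcal{E}}_{A(1)}-\widetilde{\mathcal{E}}_{A(2)}]=\sum_{a,b\ge 0}\mathbb{P}[\mathcal{E}_{A(1)}=a]\,\mathbb{P}[\mathcal{E}_{A(2)}=b]\,\mathbb{P}_{\alpha'}[X=x-a-b],$$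 with $\mathbb{P}_{\alpha'}[X=m]=0$ for $m<0$. *)

theory Defs
  imports "HOL-Probability.Probability"
begin

definition (in prob_space) cond_indep_vars ::
  "'a measure \<Rightarrow> ('i \<Rightarrow> 'b measure) \<Rightarrow> ('i \<Rightarrow> 'a \<Rightarrow> 'b) \<Rightarrow> 'i set \<Rightarrow> bool" where
  "cond_indep_vars F M' X I \<longleftrightarrow>
     (\<forall>i\<in>I. random_variable (M' i) (X i)) \<and>
     (\<forall>J B. J \<subseteq> I \<longrightarrow> finite J \<longrightarrow> J \<noteq> {} \<longrightarrow> (\<forall>j\<in>J. B j \<in> sets (M' j)) \<longrightarrow>
        (AE \<omega> in M. real_cond_exp M F (indicator {\<omega>' \<in> space M. \<forall>j\<in>J. X j \<omega>' \<in> B j}) \<omega> =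
           (\<Prod>j\<in>J. real_cond_exp M F (indicator {\<omega>' \<in> space M. X j \<omega>' \<in> B j}) \<omega>)))"

text \<open>Shape \<open>a\<close> and scale \<open>b\<close>.\<close>

definition gamma_density :: "real \<Rightarrow> real \<Rightarrow> real \<Rightarrow> real" where
  "gamma_density a b y =
     (if 0 < y then y powr (a - 1) / (b powr a * Gamma a) * exp (- y / b) else 0)"

definition unit_vec :: "nat \<Rightarrow> nat \<Rightarrow> real" where
  "unit_vec j k = (if k = j then 1 else 0)"

text \<open>
  \<open>Obl\<close> is the set of obligors. \<open>Exposure A\<close> is the generic exposure of obligor \<open>A\<close>, and
  \<open>Copy A i\<close> (only \<open>i \<ge> 1\<close> matters) are its copies entering the loss. Vectors indexed by sectors
  are functions on \<open>nat\<close>, of which only the entries \<open>0..N\<close> (\<open>S\<close>, \<open>w A\<close>) or \<open>1..N\<close> (\<open>\<alpha>\<close>) matter.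
  Both \<open>S\<close> and the intensities are almost surely positive, so that \<open>poisson_pmf\<close>, which is
  unspecified for non-positive rates, is meaningful almost everywhere.
\<close>

locale credit_risk_plus = prob_space M
  for M :: "'w measure" +
  fixes Obl :: "'o set"
    and N :: nat
    and \<alpha> :: "nat \<Rightarrow> real"
    and p :: "'o \<Rightarrow> real"
    and w :: "'o \<Rightarrow> nat \<Rightarrow> real"
    and S :: "nat \<Rightarrow> 'w \<Rightarrow> real"
    and D :: "'o \<Rightarrow> 'w \<Rightarrow> nat"
    and Exposure :: "'o \<Rightarrow> 'w \<Rightarrow> nat"
    and Copy :: "'o \<Rightarrow> nat \<Rightarrow> 'w \<Rightarrow> nat"
  assumes finite_Obl: "finite Obl"
    and N_pos: "1 \<le> N"
    and \<alpha>_pos: "\<And>k. k \<in> {1..N} \<Longrightarrow> 0 < \<alpha> k"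
    and p_pos: "\<And>A. A \<in> Obl \<Longrightarrow> 0 < p A"
    and w_bounds: "\<And>A k. A \<in> Obl \<Longrightarrow> k \<in> {0..N} \<Longrightarrow> 0 \<le> w A k \<and> w A k \<le> 1"
    and w_sum: "\<And>A. A \<in> Obl \<Longrightarrow> (\<Sum>k=0..N. w A k) = 1"
    and S_0: "\<And>\<omega>. \<omega> \<in> space M \<Longrightarrow> S 0 \<omega> = 1"
    and S_indep: "indep_vars (\<lambda>_. borel) S {1..N}"
    and S_gamma: "\<And>k. k \<in> {1..N} \<Longrightarrow>
      distributed M lborel (S k) (\<lambda>y. ennreal (gamma_density (\<alpha> k) (1 / \<alpha> k) y))"
    and D_cond_indep: "cond_indep_vars
      (vimage_algebra (space M) (\<lambda>\<omega>. \<lambda>k\<in>{0..N}. S k \<omega>) (\<Pi>\<^sub>M k\<in>{0..N}. borel))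
      (\<lambda>_. count_space UNIV) D Obl"
    and D_cond_poisson: "\<And>A n. A \<in> Obl \<Longrightarrow> AE \<omega> in M.
      real_cond_exp M
        (vimage_algebra (space M) (\<lambda>\<omega>. \<lambda>k\<in>{0..N}. S k \<omega>) (\<Pi>\<^sub>M k\<in>{0..N}. borel))
        (indicator {\<omega>' \<in> space M. D A \<omega>' = n}) \<omega> =
      pmf (poisson_pmf (p A * (\<Sum>k=0..N. w A k * S k \<omega>))) n"
    and Exposure_rv: "\<And>A. A \<in> Obl \<Longrightarrow> random_variable (count_space UNIV) (Exposure A)"
    and Copy_distr: "\<And>A i. A \<in> Obl \<Longrightarrow> 1 \<le> i \<Longrightarrow>
      distr M (count_space UNIV) (Copy A i) = distr M (count_space UNIV) (Exposure A)"
    and Copy_indep: "indep_vars (\<lambda>_. count_space UNIV) (\<lambda>(A, i). Copy A i) (Obl \<times> {1..})"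
    and Copy_indep_D_S: "indep_set
      (sets (vimage_algebra (space M) (\<lambda>\<omega>. \<lambda>(A, i)\<in>Obl \<times> {1..}. Copy A i \<omega>)
               (\<Pi>\<^sub>M _\<in>Obl \<times> {1..}. count_space UNIV)))
      (sets (vimage_algebra (space M) (\<lambda>\<omega>. (\<lambda>A\<in>Obl. D A \<omega>, \<lambda>k\<in>{0..N}. S k \<omega>))
               ((\<Pi>\<^sub>M A\<in>Obl. count_space UNIV) \<Otimes>\<^sub>M (\<Pi>\<^sub>M k\<in>{0..N}. borel))))"
begin

definition loss :: "'w \<Rightarrow> nat" where
  "loss \<omega> = (\<Sum>A\<in>Obl. \<Sum>i=1..D A \<omega>. Copy A i \<omega>)"

definition H :: "'o \<Rightarrow> complex \<Rightarrow> complex" where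
  "H A z = (LINT \<omega>|M. z ^ Exposure A \<omega>)"

definition \<mu> :: "nat \<Rightarrow> real" where
  "\<mu> k = (\<Sum>A\<in>Obl. w A k * p A)"

text \<open>If \<open>\<mu> k = 0\<close>, then \<open>\<Q> k = 0\<close> by division by zero, so \<open>\<mu> k * \<Q> k z = \<delta> k * \<Q> k z = 0\<close>.\<close>

definition \<Q> :: "nat \<Rightarrow> complex \<Rightarrow> complex" where
  "\<Q> k z = (1 / of_real (\<mu> k)) * (\<Sum>A\<in>Obl. of_real (w A k * p A) * H A z)"

definition \<delta> :: "nat \<Rightarrow> real" where
  "\<delta> k = \<mu> k / (\<mu> k + \<alpha> k)"

text \<open>
  For \<open>cmod z \<le> 1\<close> the bases have positive real part (as \<open>cmod (\<delta> k * \<Q> k z) < 1\<close>),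
  so the principal branch chosen by \<open>powr\<close> is the intended one.
\<close>

definition loss_gf :: "(nat \<Rightarrow> real) \<Rightarrow> complex \<Rightarrow> complex" where
  "loss_gf \<alpha>' z =
     exp (of_real (\<mu> 0) * (\<Q> 0 z - 1)) *
     (\<Prod>k=1..N. ((1 - of_real (\<delta> k)) / (1 - of_real (\<delta> k) * \<Q> k z)) powr of_real (\<alpha>' k))"

definition loss_law :: "(nat \<Rightarrow> real) \<Rightarrow> nat pmf" where
  "loss_law \<alpha>' =
     (THE q. \<forall>z. cmod z \<le> 1 \<longrightarrow> (\<lambda>m. of_real (pmf q m) * z ^ m) sums loss_gf \<alpha>' z)"

definition loss_prob :: "(nat \<Rightarrow> real) \<Rightarrow> int \<Rightarrow> real" where
  "loss_prob \<alpha>' m = (if m < 0 then 0 else pmf (loss_law \<alpha>') (nat m))"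

text \<open>
  The probability, for the loss distribution with parameter \<open>\<alpha>'\<close>, that the loss equals \<open>x\<close>
  minus independent exposures distributed as those of \<open>A\<close> and \<open>B\<close>.
\<close>

definition shifted_loss_prob :: "(nat \<Rightarrow> real) \<Rightarrow> int \<Rightarrow> 'o \<Rightarrow> 'o \<Rightarrow> real" where
  "shifted_loss_prob \<alpha>' x A B =
     (\<Sum>\<^sub>\<infinity>(a, b)\<in>UNIV. prob {\<omega> \<in> space M. Exposure A \<omega> = a} *
        prob {\<omega> \<in> space M. Exposure B \<omega> = b} * loss_prob \<alpha>' (x - int a - int b))"

text \<open>For a set of positive probability, this is the elementary conditional expectation.\<close>

definition cond_expectation_loss :: "('w \<Rightarrow> real) \<Rightarrow> int \<Rightarrow> real" where
  "cond_expectation_loss f x =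
     integral\<^sup>L (uniform_measure M {\<omega> \<in> space M. int (loss \<omega>) = x}) f"

end

end

(*
  Everything is read off from generating functions at real z in [0,1], where all integrands are
  non-negative. Given the sectors S, the numbers of defaults are independent Poisson variables with
  intensities l_A, so the default counts can be integrated out of E[W(S) z^X], which becomes
  E[W(S) exp(sum_A l_A (H_A(z) - 1))]; similarly
  E[D_1 D_2 z^X] = H_1(z) H_2(z) E[l_1 l_2 z^X]. The product l_1 l_2 is a quadratic polynomial in
  the sectors, and a monomial weight prod_k S_k^(r_k) turns the Gamma(alpha_k, 1/alpha_k) density
  into a multiple of the Gamma(alpha_k + r_k, 1/alpha_k) density. Hence the loss under the
  normalised weight has the generating function that defines P_(alpha + r), a priori only on [0,1]
  and, by analytic continuation, on the closed unit disc. Comparing the coefficients of z^x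
  gives the formula.
*)
theory Submission
  imports Defs "HOL-Complex_Analysis.Complex_Analysis"
begin

section \<open>Poisson and Gamma integrals\<close>

text \<open>\<open>loss_law\<close> is a definite description over the closed complex disc, so
  nothing can be said about it before some distribution is shown to have \<open>loss_gf\<close> as
  generating function there. The weighted law of the loss supplies it, and its existence is thus a
  by-product. Continuation in turn requires \<open>loss_gf\<close> to be continuous up to the
  boundary circle, with the bases of its powers kept off the branch cut. The loss has a random
  number of summands, and the assumptions on the defaults concern conditional probabilities of
  events. Independence therefore becomes usable only on an event where the default vector equals a
  fixed \<open>d\<close>. There are countably many such vectors, and sums and integrals of
  non-negative terms commute without integrability conditions. The factor H_1 H_2 comes from
  E[D h^D] = l h exp(l (h - 1)) for a Poisson variable D: each counted default carries one extra
  exposure. The constants in the formula are moments of the sectors: E[S_j^2] = (\<alpha>_j + 1) /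
  \<alpha>_j, while E[S_j] and E[S_i S_j] for distinct i, j equal 1.\<close>

lemma nn_integral_poisson_pgf:
  fixes l h :: real
  assumes "0 < l" "0 \<le> h"
  shows "(\<integral>\<^sup>+n. ennreal (h ^ n) * ennreal (pmf (poisson_pmf l) n) \<partial>count_space UNIV)
    = ennreal (exp (l * (h - 1)))"
proof -
  have "(\<lambda>n. (h * l) ^ n /\<^sub>R fact n * exp (- l)) sums (exp (h * l) * exp (- l))"
    by (intro sums_mult2 exp_converges)
  moreover have "h ^ n * pmf (poisson_pmf l) n = (h * l) ^ n /\<^sub>R fact n * exp (- l)" for n
    using assms by (simp add: field_simps power_mult_distrib)
  moreover have "exp (h * l) * exp (- l) = exp (l * (h - 1))"
    by (simp add: exp_add[symmetric] algebra_simps)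
  ultimately have "(\<lambda>n. h ^ n * pmf (poisson_pmf l) n) sums exp (l * (h - 1))"
    by simp
  from sums_unique[OF this] sums_summable[OF this] show ?thesis
    using assms
    by (simp add: nn_integral_count_space_nat ennreal_mult'[symmetric] suminf_ennreal2 del: pmf_poisson)
qed

text \<open>As n h^n = h (d/dh) h^n, this is h times the derivative of the generating function. In
  the proof the factor n removes the zeroth term and cancels against the factorial, which leaves an
  exponential series.\<close>

lemma nn_integral_poisson_pgf_deriv:
  fixes l h :: real
  assumes "0 < l" "0 \<le> h"
  shows "(\<integral>\<^sup>+n. ennreal (real n) * ennreal (h ^ n) * ennreal (pmf (poisson_pmf l) n) \<partial>count_space UNIV)
    = ennreal (l * h * exp (l * (h - 1)))"
proof -
  let ?f = "\<lambda>n. real n * h ^ n * pmf (poisson_pmf l) n"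
  have "(\<lambda>n. l * h * exp (- l) * ((h * l) ^ n /\<^sub>R fact n)) sums (l * h * exp (- l) * exp (h * l))"
    by (intro sums_mult exp_converges)
  moreover have "?f (Suc n) = l * h * exp (- l) * ((h * l) ^ n /\<^sub>R fact n)" for n
    using assms by (simp add: divide_simps power_mult_distrib)
  moreover have "l * h * exp (- l) * exp (h * l) = l * h * exp (l * (h - 1))"
    by (simp add: exp_add[symmetric] algebra_simps)
  ultimately have "(\<lambda>n. ?f (Suc n)) sums (l * h * exp (l * (h - 1)))"
    by (simp only:)
  hence "?f sums (l * h * exp (l * (h - 1)))"
    by (subst (asm) sums_Suc_iff) simp
  from sums_unique[OF this] sums_summable[OF this] show ?thesis
    using assms
    by (simp add: nn_integral_count_space_nat ennreal_mult'[symmetric] suminf_ennreal2 del: pmf_poisson)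
qed

text \<open>The substitution t = u y in the Gamma integral. The resulting factor
  \<open>u powr s\<close> is then moved to the other side by multiplying with its
  reciprocal.\<close>

lemma nn_integral_powr_exp_Gamma:
  fixes s u :: real
  assumes s: "0 < s" and u: "0 < u"
  shows "(\<integral>\<^sup>+y. ennreal (indicator {0<..} y * (y powr (s - 1) * exp (- u * y))) \<partial>lborel)
    = ennreal (Gamma s / u powr s)"
proof -
  let ?f = "\<lambda>t::real. ennreal (indicator {0<..} t * t powr (s - 1) / exp t)"
  have "ennreal (Gamma s) = (\<integral>\<^sup>+t. ennreal (indicator {0..} t * t powr (s - 1) / exp t) \<partial>lborel)"
    by (rule Gamma_conv_nn_integral_real[OF s])
  also have "\<dots> = (\<integral>\<^sup>+t. ?f t \<partial>lborel)"
    by (intro nn_integral_cong) (auto split: split_indicator)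
  also have "\<dots> = ennreal \<bar>u\<bar> * (\<integral>\<^sup>+y. ?f (0 + u * y) \<partial>lborel)"
    using u by (intro nn_integral_real_affine) auto
  also have "\<dots> = (\<integral>\<^sup>+y. ennreal (u powr s) *
      ennreal (indicator {0<..} y * (y powr (s - 1) * exp (- u * y))) \<partial>lborel)"
    using u
    by (subst nn_integral_cmult[symmetric])
       (auto intro!: nn_integral_cong split: split_indicator
         simp: zero_less_mult_iff powr_mult exp_minus field_simps powr_diff ennreal_mult'[symmetric])
  also have "\<dots> = ennreal (u powr s) *
      (\<integral>\<^sup>+y. ennreal (indicator {0<..} y * (y powr (s - 1) * exp (- u * y))) \<partial>lborel)"
    by (subst nn_integral_cmult) auto
  finally have *: "ennreal (Gamma s) = ennreal (u powr s) *
      (\<integral>\<^sup>+y. ennreal (indicator {0<..} y * (y powr (s - 1) * exp (- u * y))) \<partial>lborel)" .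
  have "ennreal (Gamma s / u powr s) = ennreal (1 / u powr s) * ennreal (Gamma s)"
    using s u by (simp add: ennreal_mult'[symmetric])
  also have "\<dots> = ennreal (1 / u powr s * u powr s) *
      (\<integral>\<^sup>+y. ennreal (indicator {0<..} y * (y powr (s - 1) * exp (- u * y))) \<partial>lborel)"
    unfolding * by (subst ennreal_mult') (auto simp: mult.assoc)
  finally show ?thesis
    using u by simp
qed

text \<open>Multiplying the density by y^r exp(-c y) gives an unnormalised Gamma density of shape a
  + r and rate c + 1/b. This is where a power of a sector turns into a shift of the parameter in the
  exponent.\<close>

lemma nn_integral_gamma_density_moment_exp:
  fixes a b c :: real
  assumes a: "0 < a" and b: "0 < b" and c: "0 \<le> c"
  shows "(\<integral>\<^sup>+y. ennreal (gamma_density a b y) * ennreal (y ^ r * exp (- c * y)) \<partial>lborel)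
    = ennreal (b ^ r * Gamma (a + real r) / Gamma a * (1 / (1 + b * c)) powr (a + real r))"
proof -
  let ?u = "c + 1 / b"
  have u: "0 < ?u"
    using b c by (simp add: add_nonneg_pos)
  have G: "Gamma a > 0"
    using a by (rule Gamma_real_pos)
  have "(\<integral>\<^sup>+y. ennreal (gamma_density a b y) * ennreal (y ^ r * exp (- c * y)) \<partial>lborel)
    = (\<integral>\<^sup>+y. ennreal (1 / (b powr a * Gamma a)) *
        ennreal (indicator {0<..} y * (y powr (a + real r - 1) * exp (- ?u * y))) \<partial>lborel)"
  proof (intro nn_integral_cong)
    fix y :: real
    show "ennreal (gamma_density a b y) * ennreal (y ^ r * exp (- c * y))
      = ennreal (1 / (b powr a * Gamma a)) *
        ennreal (indicator {0<..} y * (y powr (a + real r - 1) * exp (- ?u * y)))"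
    proof (cases "0 < y")
      case True
      have "y powr (a + real r - 1) = y powr (a - 1) * y ^ r"
        using True by (simp add: powr_realpow[symmetric] powr_add[symmetric] algebra_simps)
      moreover have "exp (- ?u * y) = exp (- c * y) * exp (- y / b)"
        by (simp add: exp_add[symmetric] algebra_simps)
      ultimately have "gamma_density a b y * (y ^ r * exp (- c * y)) = (1 / (b powr a * Gamma a)) *
        (y powr (a + real r - 1) * exp (- ?u * y))"
        using True by (simp add: gamma_density_def)
      moreover have "0 \<le> gamma_density a b y"
        using G by (simp add: gamma_density_def)
      ultimately show ?thesis
        using True G by (simp add: ennreal_mult'[symmetric])
    qed (simp add: gamma_density_def)
  qed
  also have "\<dots> = ennreal (1 / (b powr a * Gamma a)) * ennreal (Gamma (a + real r) / ?u powr (a + real r))"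
    using nn_integral_powr_exp_Gamma[OF _ u, of "a + real r"] a by (subst nn_integral_cmult) auto
  also have "\<dots> = ennreal (1 / (b powr a * Gamma a) * (Gamma (a + real r) / ?u powr (a + real r)))"
    using G by (simp add: ennreal_mult'[symmetric])
  also have "?u = (1 + b * c) / b"
    using b by (simp add: field_simps)
  also have "((1 + b * c) / b) powr (a + real r) = (1 + b * c) powr (a + real r) / (b powr a * b ^ r)"
    using b c by (simp add: powr_divide powr_add powr_realpow)
  also have "1 / (b powr a * Gamma a) * (Gamma (a + real r) / ((1 + b * c) powr (a + real r) / (b powr a * b ^ r)))
     = b ^ r * Gamma (a + real r) / Gamma a * (1 / (1 + b * c)) powr (a + real r)"
    using b c by (simp add: powr_divide)
  finally show ?thesis .
qed

section \<open>Power series with summable coefficients\<close>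

text \<open>The zeros of a nonzero power series do not accumulate at 0, so agreement on the
  one-sided neighbourhood [0,1) is enough.\<close>

lemma powser_eq_imp_coeff_eq:
  fixes a b :: "nat \<Rightarrow> real"
  assumes "summable (\<lambda>n. \<bar>a n\<bar>)" "summable (\<lambda>n. \<bar>b n\<bar>)"
    and eq: "\<And>z. 0 \<le> z \<Longrightarrow> z < 1 \<Longrightarrow> (\<Sum>n. a n * z ^ n) = (\<Sum>n. b n * z ^ n)"
  shows "a = b"
proof (rule ccontr)
  assume "a \<noteq> b"
  then obtain m where m: "a m - b m \<noteq> 0"
    by auto
  have summable: "summable (\<lambda>n. f n * z ^ n)" if "summable (\<lambda>n. \<bar>f n\<bar>)" "\<bar>z\<bar> < 1" for f :: "nat \<Rightarrow> real" and z
  proof (rule summable_comparison_test'[OF that(1), of 0])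
    fix n :: nat
    have "\<bar>z\<bar> ^ n \<le> 1"
      using that by (intro power_le_one) auto
    thus "norm (f n * z ^ n) \<le> \<bar>f n\<bar>"
      by (simp add: abs_mult power_abs mult_left_le)
  qed
  let ?F = "\<lambda>z. \<Sum>n. (a n - b n) * z ^ n"
  have sums: "(\<lambda>n. (a n - b n) * z ^ n) sums ?F z" if "\<bar>z\<bar> < 1" for z
    using summable_diff[OF summable[OF assms(1) that] summable[OF assms(2) that]]
    by (simp add: summable_sums left_diff_distrib)
  have zero: "?F z = 0" if "0 \<le> z" "z < 1" for z
    using suminf_diff[OF summable[OF assms(1), of z] summable[OF assms(2), of z]] eq[OF that] that
    by (simp add: left_diff_distrib)
  \<comment> \<open>\<open>powser_0_nonzero\<close> wants a nonzero coefficient of positive index.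
    The constant coefficient of the difference vanishes by evaluation at 0.\<close>
  from zero[of 0] have "a 0 - b 0 = 0"
    by simp
  with m have "m > 0"
    by (cases m) auto
  obtain s where s: "0 < s" "\<And>z. z \<in> cball 0 s - {0} \<Longrightarrow> ?F z \<noteq> 0"
    using powser_0_nonzero[where \<xi>=0 and r=1 and f="?F" and a="\<lambda>n. a n - b n" and m=m]
      sums m \<open>m > 0\<close> zero[of 0] by auto
  \<comment> \<open>The bound \<open>s\<close> keeps \<open>t\<close> where the difference is
    nonzero, the bound 1/2 keeps it in [0,1), where the difference is zero.\<close>
  define t where "t = min s (1/2)"
  have "0 < t" "t \<le> s" "t < 1"
    using s(1) by (auto simp: t_def)
  with s(2)[of t] zero[of t] show False
    by auto
qed

text \<open>The value z = 1 transfers finiteness of the total mass from \<open>u\<close> to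
  \<open>v\<close>. All coefficients are then finite and summable, and the question becomes one
  about real power series. Without finiteness both series could be infinite and carry no
  information.\<close>

lemma nn_integral_powser_eq_imp_coeff_eq:
  fixes u v :: "nat \<Rightarrow> ennreal"
  assumes eq: "\<And>z. 0 \<le> z \<Longrightarrow> z \<le> 1 \<Longrightarrow>
      (\<integral>\<^sup>+n. u n * ennreal (z ^ n) \<partial>count_space UNIV) = (\<integral>\<^sup>+n. v n * ennreal (z ^ n) \<partial>count_space UNIV)"
    and fin: "(\<integral>\<^sup>+n. u n \<partial>count_space UNIV) \<noteq> \<infinity>"
  shows "u = v"
proof -
  have fin': "(\<integral>\<^sup>+n. v n \<partial>count_space UNIV) \<noteq> \<infinity>"
    using eq[of 1] fin by simp
  have ex: "\<exists>a. (\<forall>n. f n = ennreal (a n) \<and> 0 \<le> a n) \<and> summable a \<and>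
      (\<forall>z. 0 \<le> z \<longrightarrow> z \<le> 1 \<longrightarrow> (\<integral>\<^sup>+n. f n * ennreal (z ^ n) \<partial>count_space UNIV) = ennreal (\<Sum>n. a n * z ^ n)
         \<and> 0 \<le> (\<Sum>n. a n * z ^ n))"
    if f: "(\<integral>\<^sup>+n. f n \<partial>count_space UNIV) \<noteq> \<infinity>" for f :: "nat \<Rightarrow> ennreal"
  proof -
    define a where "a n = enn2real (f n)" for n
    have "f n \<noteq> \<infinity>" for n
    proof
      assume "f n = \<infinity>"
      moreover have "f n \<le> (\<integral>\<^sup>+n. f n \<partial>count_space UNIV)"
        by (rule nn_integral_ge_point) simp
      ultimately show False
        using f by (simp add: top_unique)
    qed
    hence a: "f n = ennreal (a n)" "0 \<le> a n" for n
      by (auto simp: a_def top.not_eq_extremum)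
    have s: "summable a"
      using f a by (intro summable_suminf_not_top) (auto simp: nn_integral_count_space_nat)
    have "(\<integral>\<^sup>+n. f n * ennreal (z ^ n) \<partial>count_space UNIV) = ennreal (\<Sum>n. a n * z ^ n)
         \<and> 0 \<le> (\<Sum>n. a n * z ^ n)" if z: "0 \<le> z" "z \<le> 1" for z
    proof -
      have "summable (\<lambda>n. a n * z ^ n)"
        using a z by (intro summable_comparison_test'[OF s, of 0])
          (auto simp: abs_mult mult_left_le power_le_one)
      with a z show ?thesis
        by (simp add: nn_integral_count_space_nat ennreal_mult'[symmetric] suminf_ennreal2 suminf_nonneg)
    qed
    with a s show ?thesis
      by blast
  qed
  obtain a where a: "\<And>n. u n = ennreal (a n)" "\<And>n. 0 \<le> a n" "summable a"
    "\<And>z. 0 \<le> z \<Longrightarrow> z \<le> 1 \<Longrightarrow> (\<integral>\<^sup>+n. u n * ennreal (z ^ n) \<partial>count_space UNIV) = ennreal (\<Sum>n. a n * z ^ n)"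
    "\<And>z. 0 \<le> z \<Longrightarrow> z \<le> 1 \<Longrightarrow> 0 \<le> (\<Sum>n. a n * z ^ n)"
    using ex[OF fin] by blast
  obtain b where b: "\<And>n. v n = ennreal (b n)" "\<And>n. 0 \<le> b n" "summable b"
    "\<And>z. 0 \<le> z \<Longrightarrow> z \<le> 1 \<Longrightarrow> (\<integral>\<^sup>+n. v n * ennreal (z ^ n) \<partial>count_space UNIV) = ennreal (\<Sum>n. b n * z ^ n)"
    "\<And>z. 0 \<le> z \<Longrightarrow> z \<le> 1 \<Longrightarrow> 0 \<le> (\<Sum>n. b n * z ^ n)"
    using ex[OF fin'] by blast
  have "a = b"
  proof (rule powser_eq_imp_coeff_eq)
    show "(\<Sum>n. a n * z ^ n) = (\<Sum>n. b n * z ^ n)" if "0 \<le> z" "z < 1" for z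
    proof -
      have "z \<le> 1"
        using that by simp
      from eq[OF that(1) this] show ?thesis
        unfolding a(4)[OF that(1) \<open>z \<le> 1\<close>] b(4)[OF that(1) \<open>z \<le> 1\<close>]
        using a(5)[OF that(1) \<open>z \<le> 1\<close>] b(5)[OF that(1) \<open>z \<le> 1\<close>] by (simp add: ennreal_inj)
    qed
  qed (use a b in auto)
  with a b show ?thesis
    by auto
qed

section \<open>Continuation from the unit interval to the closed unit disc\<close>

lemma summable_powser_unit_disc:
  fixes a :: "nat \<Rightarrow> real" and z :: complex
  assumes "summable (\<lambda>n. \<bar>a n\<bar>)" "cmod z \<le> 1"
  shows "summable (\<lambda>n. of_real (a n) * z ^ n)"
proof (rule summable_comparison_test'[OF assms(1), of 0])
  show "norm (of_real (a n) * z ^ n) \<le> \<bar>a n\<bar>" for n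
    using assms(2) by (simp add: norm_mult norm_power mult_left_le power_le_one)
qed

lemma powser_holomorphic_unit_disc:
  fixes a :: "nat \<Rightarrow> real"
  assumes "summable (\<lambda>n. \<bar>a n\<bar>)"
  shows "(\<lambda>z. \<Sum>n. of_real (a n) * z ^ n) holomorphic_on ball 0 1"
  using summable_sums[OF summable_powser_unit_disc[OF assms]]
  by (intro power_series_holomorphic[where a="\<lambda>n. of_real (a n)"]) auto

text \<open>The majorant \<open>\<bar>a n\<bar>\<close> does not depend on z, so convergence is
  uniform on the closed disc. This covers the boundary circle, about which holomorphy inside says
  nothing.\<close>

lemma powser_continuous_unit_disc:
  fixes a :: "nat \<Rightarrow> real"
  assumes "summable (\<lambda>n. \<bar>a n\<bar>)"
  shows "continuous_on (cball (0::complex) 1) (\<lambda>z. \<Sum>n. of_real (a n) * z ^ n)"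
proof (rule uniform_limit_theorem)
  show "uniform_limit (cball (0::complex) 1) (\<lambda>m z. \<Sum>n<m. of_real (a n) * z ^ n)
      (\<lambda>z. \<Sum>n. of_real (a n) * z ^ n) sequentially"
    by (rule Weierstrass_m_test[OF _ assms])
       (auto simp: norm_mult norm_power mult_left_le power_le_one)
qed (auto intro!: always_eventually continuous_intros)

text \<open>The interval (0,1) accumulates at the interior point 0, so the identity theorem gives
  equality on the open disc; continuity of both sides then carries it to the closure.\<close>

lemma sums_unit_disc_if_sums_unit_interval:
  fixes a :: "nat \<Rightarrow> real" and F :: "complex \<Rightarrow> complex"
  assumes a: "summable (\<lambda>n. \<bar>a n\<bar>)"
    and hol: "F holomorphic_on ball 0 1" and cont: "continuous_on (cball 0 1) F"
    and eq: "\<And>z::real. 0 \<le> z \<Longrightarrow> z \<le> 1 \<Longrightarrow> F (of_real z) = of_real (\<Sum>n. a n * z ^ n)"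
    and z: "cmod z \<le> 1"
  shows "(\<lambda>n. of_real (a n) * z ^ n) sums F z"
proof -
  let ?G = "\<lambda>z. \<Sum>n. of_real (a n) * z ^ n"
  let ?U = "of_real ` {0<..<1::real} :: complex set"
  have on_ball: "F z - ?G z = 0" if "z \<in> ball 0 1" for z
  proof (rule analytic_continuation[where f="\<lambda>z. F z - ?G z" and S="ball 0 1" and U="?U" and \<xi>=0])
    show "(\<lambda>z. F z - ?G z) holomorphic_on ball 0 1"
      by (intro holomorphic_intros hol powser_holomorphic_unit_disc a)
    show "(0::complex) islimpt ?U"
      unfolding islimpt_approachable
    proof (intro allI impI)
      fix e :: real assume "0 < e"
      thus "\<exists>x'\<in>?U. x' \<noteq> 0 \<and> dist x' 0 < e"
        by (intro bexI[of _ "of_real (min (e/2) (1/2))"]) auto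
    qed
    show "F w - ?G w = 0" if w: "w \<in> ?U" for w
    proof -
      obtain x where x: "w = of_real x" "0 < x" "x < 1"
        using w by auto
      have "summable (\<lambda>n. a n * x ^ n)"
        using a x by (intro summable_comparison_test'[OF a, of 0])
          (auto simp: abs_mult mult_left_le power_le_one)
      hence "?G w = of_real (\<Sum>n. a n * x ^ n)"
        using x by (simp add: suminf_of_real flip: of_real_mult of_real_power)
      with eq[of x] x show ?thesis
        by simp
    qed
  qed (use that in auto)
  have "F z - ?G z = 0"
  proof (rule continuous_constant_on_closure[where S="ball 0 1" and f="\<lambda>z. F z - ?G z" and a=0])
    show "continuous_on (closure (ball 0 1)) (\<lambda>z. F z - ?G z)"
      using continuous_on_diff[OF cont powser_continuous_unit_disc[OF a]] by simp
  qed (use z on_ball in auto)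
  thus ?thesis
    using summable_sums[OF summable_powser_unit_disc[OF a z]] by simp
qed

text \<open>The Cauchy product by Tonelli, valid in \<open>ennreal\<close> whether or not the series
  converge.\<close>

lemma nn_integral_powser_mult:
  fixes f g :: "nat \<Rightarrow> ennreal"
  assumes z: "0 \<le> z"
  shows "(\<integral>\<^sup>+n. f n * ennreal (z ^ n) \<partial>count_space UNIV) * (\<integral>\<^sup>+n. g n * ennreal (z ^ n) \<partial>count_space UNIV)
    = (\<integral>\<^sup>+n. (\<Sum>i\<le>n. f i * g (n - i)) * ennreal (z ^ n) \<partial>count_space UNIV)"
proof -
  \<comment> \<open>The indicator extends both sums to all of \<open>nat\<close>, so that they can
    be swapped, and it removes the terms with n < i, where \<open>n - i\<close> is truncated to
    0.\<close>
  let ?F = "\<lambda>i n. f i * g (n - i) * ennreal (z ^ n) * indicator {i..} n"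
  have inner: "f i * ennreal (z ^ i) * (\<integral>\<^sup>+n. g n * ennreal (z ^ n) \<partial>count_space UNIV)
      = (\<integral>\<^sup>+n. ?F i n \<partial>count_space UNIV)" for i
  proof -
    have "f i * ennreal (z ^ i) * (\<integral>\<^sup>+n. g n * ennreal (z ^ n) \<partial>count_space UNIV)
        = (\<integral>\<^sup>+j. f i * g j * ennreal (z ^ (i + j)) \<partial>count_space UNIV)"
      using z by (subst nn_integral_cmult[symmetric])
        (auto intro!: nn_integral_cong simp: power_add ennreal_mult mult_ac)
    also have "\<dots> = (\<integral>\<^sup>+j. f i * g ((i + j) - i) * ennreal (z ^ (i + j)) \<partial>count_space UNIV)"
      by simp
    also have "\<dots> = (\<integral>\<^sup>+n. f i * g (n - i) * ennreal (z ^ n) \<partial>count_space (range ((+) i)))"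
      by (rule nn_integral_bij_count_space) (simp add: inj_on_imp_bij_betw)
    also have "range ((+) i) = {i..}"
      by (auto simp: image_iff le_iff_add)
    also have "(\<integral>\<^sup>+n. f i * g (n - i) * ennreal (z ^ n) \<partial>count_space {i..}) = (\<integral>\<^sup>+n. ?F i n \<partial>count_space UNIV)"
      by (rule nn_integral_count_space_indicator) simp
    finally show ?thesis .
  qed
  have "(\<integral>\<^sup>+i. f i * ennreal (z ^ i) \<partial>count_space UNIV) * (\<integral>\<^sup>+n. g n * ennreal (z ^ n) \<partial>count_space UNIV)
    = (\<integral>\<^sup>+i. f i * ennreal (z ^ i) * (\<integral>\<^sup>+n. g n * ennreal (z ^ n) \<partial>count_space UNIV) \<partial>count_space UNIV)"
    by (rule nn_integral_multc[symmetric]) simp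
  also have "\<dots> = (\<integral>\<^sup>+i. (\<integral>\<^sup>+n. ?F i n \<partial>count_space UNIV) \<partial>count_space UNIV)"
    unfolding inner ..
  also have "\<dots> = (\<integral>\<^sup>+n. (\<integral>\<^sup>+i. ?F i n \<partial>count_space UNIV) \<partial>count_space UNIV)"
    by (rule nn_integral_count_space_nn_integral) auto
  also have "\<dots> = (\<integral>\<^sup>+n. (\<Sum>i\<le>n. f i * g (n - i)) * ennreal (z ^ n) \<partial>count_space UNIV)"
  proof (rule nn_integral_cong)
    fix n
    have "(\<integral>\<^sup>+i. ?F i n \<partial>count_space UNIV) = (\<Sum>i\<le>n. ?F i n)"
      by (rule nn_integral_count_space') auto
    thus "(\<integral>\<^sup>+i. ?F i n \<partial>count_space UNIV) = (\<Sum>i\<le>n. f i * g (n - i)) * ennreal (z ^ n)"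
      by (simp add: sum_distrib_right)
  qed
  finally show ?thesis .
qed

section \<open>Independence, conditioning and fibres\<close>

lemma (in prob_space) indep_var_nn_integral:
  fixes X Y :: "'a \<Rightarrow> ennreal"
  assumes "indep_var borel X borel Y"
  shows "(\<integral>\<^sup>+\<omega>. X \<omega> * Y \<omega> \<partial>M) = (\<integral>\<^sup>+\<omega>. X \<omega> \<partial>M) * (\<integral>\<^sup>+\<omega>. Y \<omega> \<partial>M)"
proof -
  have "(\<lambda>_. borel :: ennreal measure) = case_bool borel borel"
    by (rule ext) (auto split: bool.split)
  with assms have "indep_vars (\<lambda>_. borel) (case_bool X Y) UNIV"
    by (simp add: indep_var_def)
  from indep_vars_nn_integral[OF _ this] show ?thesis
    by (simp add: UNIV_bool mult.commute)
qed

text \<open>\<open>real_cond_exp\<close> is the difference of the \<open>enn2real\<close> values for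
  the positive and the negative part. The negative part vanishes here, and the bound by 1 excludes
  the value \<open>top\<close>, which \<open>enn2real\<close> would send to 0.\<close>

lemma (in sigma_finite_subalgebra) nn_cond_exp_eq_real_cond_exp:
  assumes [measurable]: "f \<in> borel_measurable M" and f: "\<And>x. 0 \<le> f x" "\<And>x. f x \<le> 1"
  shows "AE x in M. nn_cond_exp M F (\<lambda>x. ennreal (f x)) x = ennreal (real_cond_exp M F f x)"
proof -
  have neg: "(\<lambda>x. ennreal (- f x)) = (\<lambda>_. 0)"
    using f by (auto simp: ennreal_neg)
  have "AE x in M. nn_cond_exp M F (\<lambda>x. ennreal (f x)) x \<le> nn_cond_exp M F (\<lambda>_. 1) x"
    using f by (intro nn_cond_exp_mono) auto
  moreover have "AE x in M. 1 = nn_cond_exp M F (\<lambda>_. 1) x"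
    by (rule nn_cond_exp_F_meas) simp
  moreover have "AE x in M. 0 = nn_cond_exp M F (\<lambda>_. 0) x"
    by (rule nn_cond_exp_F_meas) simp
  ultimately show ?thesis
  proof eventually_elim
    case (elim x)
    have "nn_cond_exp M F (\<lambda>x. ennreal (f x)) x < top"
      using elim(1,2) ennreal_one_less_top by (metis order.strict_trans1)
    with elim(3) neg show ?case
      by (simp add: real_cond_exp_def)
  qed
qed

text \<open>The model states independence of two large sigma-algebras. A variable measurable with
  respect to one of them generates a smaller one, and independence passes down.\<close>

lemma (in prob_space) indep_var_if_indep_set:
  assumes "indep_set (sets F) (sets G)"
    and "X \<in> measurable F S" "Y \<in> measurable G T"
    and "space F = space M" "space G = space M"
  shows "indep_var S X T Y"
proof -
  have F: "sets F \<subseteq> events" and G: "sets G \<subseteq> events"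
    using indep_setD_ev1[OF assms(1)] indep_setD_ev2[OF assms(1)] .
  have X: "X \<in> measurable M S"
    using measurable_mono[OF order_refl refl F] assms(2,4) by auto
  have Y: "Y \<in> measurable M T"
    using measurable_mono[OF order_refl refl G] assms(3,5) by auto
  have subX: "sigma_sets (space M) {X -` A \<inter> space M | A. A \<in> sets S} \<subseteq> sets F"
    using measurable_sets[OF assms(2)] unfolding assms(4)[symmetric]
    by (intro sets.sigma_sets_subset) auto
  have subY: "sigma_sets (space M) {Y -` A \<inter> space M | A. A \<in> sets T} \<subseteq> sets G"
    using measurable_sets[OF assms(3)] unfolding assms(5)[symmetric]
    by (intro sets.sigma_sets_subset) auto
  have "indep_set (sigma_sets (space M) {X -` A \<inter> space M | A. A \<in> sets S})
      (sigma_sets (space M) {Y -` A \<inter> space M | A. A \<in> sets T})"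
    using assms(1) unfolding indep_set_def
    by (rule indep_sets_mono_sets) (use subX subY in \<open>auto split: bool.split\<close>)
  with X Y show ?thesis
    by (simp add: indep_var_eq)
qed

text \<open>Used to freeze a discrete variable at each of its values: the default vector, the loss,
  or an exposure.\<close>

lemma nn_integral_eq_nn_integral_fiber:
  fixes X :: "'a \<Rightarrow> 'b" and f :: "'a \<Rightarrow> ennreal"
  assumes C: "countable C" and X: "\<And>\<omega>. \<omega> \<in> space M \<Longrightarrow> X \<omega> \<in> C"
    and meas [measurable]: "f \<in> borel_measurable M" "X \<in> measurable M (count_space C)"
  shows "(\<integral>\<^sup>+\<omega>. f \<omega> \<partial>M) = (\<integral>\<^sup>+c. (\<integral>\<^sup>+\<omega>. f \<omega> * indicator {\<omega>. X \<omega> = c} \<omega> \<partial>M) \<partial>count_space C)"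
proof -
  have "(\<integral>\<^sup>+\<omega>. f \<omega> \<partial>M) = (\<integral>\<^sup>+\<omega>. (\<integral>\<^sup>+c. f \<omega> * indicator {\<omega>. X \<omega> = c} \<omega> \<partial>count_space C) \<partial>M)"
  proof (intro nn_integral_cong)
    fix \<omega> assume "\<omega> \<in> space M"
    thus "f \<omega> = (\<integral>\<^sup>+c. f \<omega> * indicator {\<omega>. X \<omega> = c} \<omega> \<partial>count_space C)"
      using X by (subst nn_integral_count_space'[where A="{X \<omega>}"]) auto
  qed
  also have "\<dots> = (\<integral>\<^sup>+c. (\<integral>\<^sup>+\<omega>. f \<omega> * indicator {\<omega>. X \<omega> = c} \<omega> \<partial>M) \<partial>count_space C)"
    using C
  proof (rule nn_integral_count_space_nn_integral)
    fix c assume "c \<in> C"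
    have "{\<omega> \<in> space M. X \<omega> = c} \<in> sets M"
      using meas(2) C \<open>c \<in> C\<close> measurable_sets[OF meas(2), of "{c}"] by (auto simp: vimage_def Int_def conj_commute)
    hence "(\<lambda>\<omega>. f \<omega> * indicator {\<omega> \<in> space M. X \<omega> = c} \<omega>) \<in> borel_measurable M"
      by measurable
    thus "(\<lambda>\<omega>. f \<omega> * indicator {\<omega>. X \<omega> = c} \<omega>) \<in> borel_measurable M"
      by (rule measurable_cong[THEN iffD1, rotated]) (auto split: split_indicator)
  qed
  finally show ?thesis .
qed

lemma (in prob_space) prob_nat_sums:
  fixes X :: "'a \<Rightarrow> nat"
  assumes [measurable]: "X \<in> measurable M (count_space UNIV)"
  shows "(\<lambda>n. prob {\<omega> \<in> space M. X \<omega> = n}) sums 1"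
proof -
  have "(\<Union>n. {\<omega> \<in> space M. X \<omega> = n}) = space M"
    by auto
  moreover have "(\<lambda>n. prob {\<omega> \<in> space M. X \<omega> = n}) sums prob (\<Union>n. {\<omega> \<in> space M. X \<omega> = n})"
    by (intro finite_measure_UNION) (auto simp: disjoint_family_on_def)
  ultimately show ?thesis
    by (simp add: prob_space)
qed

text \<open>For \<open>cmod z \<le> 1\<close> the norms of the terms are dominated by the point
  probabilities, so sum and integral may be exchanged, also on the boundary circle.\<close>

lemma (in prob_space) expectation_power_sums:
  fixes X :: "'a \<Rightarrow> nat" and z :: complex
  assumes X [measurable]: "X \<in> measurable M (count_space UNIV)" and z: "cmod z \<le> 1"
  shows "(\<lambda>n. of_real (prob {\<omega> \<in> space M. X \<omega> = n}) * z ^ n) sums (LINT \<omega>|M. z ^ X \<omega>)"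
proof -
  let ?f = "\<lambda>n \<omega>. indicat_real {\<omega> \<in> space M. X \<omega> = n} \<omega> *\<^sub>R z ^ n"
  have eq: "?f n \<omega> = (if n = X \<omega> then z ^ n else 0)" if "\<omega> \<in> space M" for n \<omega>
    using that by auto
  have sums: "(\<lambda>n. ?f n \<omega>) sums z ^ X \<omega>" if "\<omega> \<in> space M" for \<omega>
    unfolding eq[OF that] by (rule sums_single)
  have "(\<lambda>n. integral\<^sup>L M (?f n)) sums (\<integral>\<omega>. (\<Sum>n. ?f n \<omega>) \<partial>M)"
  proof (rule sums_integral)
    show "integrable M (?f n)" for n
      by (intro integrable_scaleR_left integrable_real_indicator) (auto simp: emeasure_eq_measure)
    show "AE \<omega> in M. summable (\<lambda>n. norm (?f n \<omega>))"
    proof (intro AE_I2)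
      fix \<omega> assume "\<omega> \<in> space M"
      thus "summable (\<lambda>n. norm (?f n \<omega>))"
        by (intro summable_finite[of "{X \<omega>}"]) auto
    qed
    have "(\<integral>\<omega>. norm (?f n \<omega>) \<partial>M) = prob {\<omega> \<in> space M. X \<omega> = n} * cmod z ^ n" for n
      by (simp add: norm_power)
    moreover have "summable (\<lambda>n. prob {\<omega> \<in> space M. X \<omega> = n} * cmod z ^ n)"
      using z by (intro summable_comparison_test'[OF sums_summable[OF prob_nat_sums[OF X]], of 0])
        (auto intro!: mult_left_le power_le_one)
    ultimately show "summable (\<lambda>n. \<integral>\<omega>. norm (?f n \<omega>) \<partial>M)"
      by (simp only:)
  qed
  also have "(\<integral>\<omega>. (\<Sum>n. ?f n \<omega>) \<partial>M) = (LINT \<omega>|M. z ^ X \<omega>)"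
    using sums by (intro Bochner_Integration.integral_cong) (auto simp: sums_iff)
  finally show ?thesis
    by (simp add: scaleR_conv_of_real)
qed

lemma ennreal_double_sum:
  assumes "\<And>i j. i \<in> I \<Longrightarrow> j \<in> J i \<Longrightarrow> 0 \<le> f i j"
  shows "ennreal (\<Sum>i\<in>I. \<Sum>j\<in>J i. f i j) = (\<Sum>i\<in>I. \<Sum>j\<in>J i. ennreal (f i j))"
proof -
  have "ennreal (\<Sum>i\<in>I. \<Sum>j\<in>J i. f i j) = (\<Sum>i\<in>I. ennreal (\<Sum>j\<in>J i. f i j))"
    using assms by (intro sum_ennreal[symmetric] sum_nonneg)
  also have "\<dots> = (\<Sum>i\<in>I. \<Sum>j\<in>J i. ennreal (f i j))"
    using assms by (intro sum.cong refl sum_ennreal[symmetric])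
  finally show ?thesis .
qed

context credit_risk_plus
begin

section \<open>The joint transform of defaults and loss\<close>

text \<open>Restricted to {0..N}, so that it is literally the map that generates the conditioning
  sigma-algebra in the model assumptions.\<close>

definition sectors :: "'w \<Rightarrow> nat \<Rightarrow> real" where
  "sectors \<omega> = (\<lambda>k\<in>{0..N}. S k \<omega>)"

definition defaults :: "'w \<Rightarrow> 'o \<Rightarrow> nat" where
  "defaults \<omega> = (\<lambda>A\<in>Obl. D A \<omega>)"

definition intensity :: "'o \<Rightarrow> 'w \<Rightarrow> real" where
  "intensity A \<omega> = p A * (\<Sum>k=0..N. w A k * S k \<omega>)"

definition exposure_pgf :: "'o \<Rightarrow> real \<Rightarrow> real" where
  "exposure_pgf A z = (LINT \<omega>|M. z ^ Exposure A \<omega>)"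

lemma S_measurable [measurable]: "k \<in> {0..N} \<Longrightarrow> S k \<in> borel_measurable M"
proof (cases "k = 0")
  case True
  have "(\<lambda>_. 1) \<in> borel_measurable M"
    by simp
  thus ?thesis
    using S_0 True by (subst measurable_cong) auto
next
  case False
  assume "k \<in> {0..N}"
  with False S_indep show ?thesis
    by (auto simp: indep_vars_def)
qed

lemma D_measurable [measurable]: "A \<in> Obl \<Longrightarrow> D A \<in> measurable M (count_space UNIV)"
  using D_cond_indep by (auto simp: cond_indep_vars_def)

lemma Copy_measurable [measurable]:
  "A \<in> Obl \<Longrightarrow> 1 \<le> i \<Longrightarrow> Copy A i \<in> measurable M (count_space UNIV)"
  using Copy_indep by (auto simp: indep_vars_def)

lemma sectors_measurable [measurable]: "sectors \<in> measurable M (PiM {0..N} (\<lambda>_. borel))"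
  unfolding sectors_def by (intro measurable_restrict) auto

text \<open>With finitely many obligors the space of default vectors is discrete and countable, so
  one may sum over its points.\<close>

lemma PiM_Obl_eq_count_space: "PiM Obl (\<lambda>_. count_space UNIV) = count_space (PiE Obl (\<lambda>_. UNIV :: nat set))"
  using finite_Obl by (intro count_space_PiM_finite) auto

lemma countable_PiE_Obl: "countable (PiE Obl (\<lambda>_. UNIV :: nat set))"
  using finite_Obl by (intro countable_PiE) auto

lemma defaults_measurable [measurable]: "defaults \<in> measurable M (count_space (PiE Obl (\<lambda>_. UNIV)))"
  unfolding defaults_def PiM_Obl_eq_count_space[symmetric] by (intro measurable_restrict) auto

lemma defaults_in_PiE: "defaults \<omega> \<in> PiE Obl (\<lambda>_. UNIV)"
  by (simp add: defaults_def)

lemma defaults_eq_measurable [measurable]: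
  assumes "d \<in> PiE Obl (\<lambda>_. UNIV)"
  shows "(\<lambda>\<omega>. indicator {\<omega>. defaults \<omega> = d} \<omega> :: ennreal) \<in> borel_measurable M"
proof -
  have "(\<lambda>\<omega>. (\<lambda>c. indicator {d} c :: ennreal) (defaults \<omega>)) \<in> borel_measurable M"
    by (rule measurable_compose[OF defaults_measurable]) simp
  thus ?thesis
    by (simp add: indicator_def)
qed

lemma loss_measurable [measurable]: "loss \<in> measurable M (count_space UNIV)"
proof -
  have "(\<lambda>\<omega>. \<Sum>i=1..D A \<omega>. Copy A i \<omega>) \<in> measurable M (count_space UNIV)" if "A \<in> Obl" for A
  \<comment> \<open>The upper summation bound is random; splitting according to its countably many
    values leaves sums of fixed length.\<close>
  proof (rule measurable_compose_countable[OF _ D_measurable[OF that]])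
    show "(\<lambda>\<omega>. \<Sum>i=1..n. Copy A i \<omega>) \<in> measurable M (count_space UNIV)" for n
      using that by (intro measurable_sum_nat) auto
  qed
  thus ?thesis
    unfolding loss_def by (intro measurable_sum_nat)
qed

lemma exposure_pgf_nonneg: "0 \<le> z \<Longrightarrow> 0 \<le> exposure_pgf A z"
  unfolding exposure_pgf_def by (intro Bochner_Integration.integral_nonneg) auto

lemma nn_integral_pow_Exposure:
  assumes "A \<in> Obl" "0 \<le> z" "z \<le> 1"
  shows "(\<integral>\<^sup>+\<omega>. ennreal (z ^ Exposure A \<omega>) \<partial>M) = ennreal (exposure_pgf A z)"
proof -
  note [measurable] = Exposure_rv[OF assms(1)]
  show ?thesis
    unfolding exposure_pgf_def
  proof (rule nn_integral_eq_integral)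
    show "integrable M (\<lambda>\<omega>. z ^ Exposure A \<omega>)"
      using assms by (intro integrable_const_bound[where B=1]) (auto intro!: power_le_one)
  qed (use assms in auto)
qed

lemma exposure_pgf_le_1:
  assumes "A \<in> Obl" "0 \<le> z" "z \<le> 1"
  shows "exposure_pgf A z \<le> 1"
proof -
  have "ennreal (exposure_pgf A z) \<le> (\<integral>\<^sup>+\<omega>. 1 \<partial>M)"
    unfolding nn_integral_pow_Exposure[OF assms, symmetric]
    using assms by (intro nn_integral_mono) (auto intro!: power_le_one)
  thus ?thesis
    by (simp add: emeasure_space_1)
qed

lemma nn_integral_pow_Copy:
  assumes "A \<in> Obl" "1 \<le> i" "0 \<le> z" "z \<le> 1"
  shows "(\<integral>\<^sup>+\<omega>. ennreal (z ^ Copy A i \<omega>) \<partial>M) = ennreal (exposure_pgf A z)"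
proof -
  note [measurable] = Exposure_rv[OF assms(1)] Copy_measurable[OF assms(1,2)]
  have "(\<integral>\<^sup>+\<omega>. ennreal (z ^ Copy A i \<omega>) \<partial>M) = (\<integral>\<^sup>+n. ennreal (z ^ n) \<partial>distr M (count_space UNIV) (Copy A i))"
    by (subst nn_integral_distr) auto
  also have "\<dots> = (\<integral>\<^sup>+\<omega>. ennreal (z ^ Exposure A \<omega>) \<partial>M)"
    unfolding Copy_distr[OF assms(1,2)] by (subst nn_integral_distr) auto
  finally show ?thesis
    using nn_integral_pow_Exposure assms by simp
qed

text \<open>For fixed counts \<open>d\<close> only finitely many copies occur, indexed by a
  \<open>Sigma\<close> set, and their independence turns the expectation of the product into a
  product of expectations.\<close>

lemma nn_integral_pow_sum_Copy:
  assumes z: "0 \<le> z" "z \<le> 1"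
  shows "(\<integral>\<^sup>+\<omega>. ennreal (z ^ (\<Sum>A\<in>Obl. \<Sum>i=1..d A. Copy A i \<omega>)) \<partial>M) = (\<Prod>A\<in>Obl. ennreal (exposure_pgf A z ^ d A))"
proof -
  let ?J = "Sigma Obl (\<lambda>A. {1..d A})"
  let ?X = "\<lambda>q \<omega>. ennreal (z ^ (case q of (A, i) \<Rightarrow> Copy A i) \<omega>)"
  have "?J \<subseteq> Obl \<times> {1..}"
    by auto
  from indep_vars_subset[OF Copy_indep this]
  have "indep_vars (\<lambda>_. borel) ?X ?J"
    by (rule indep_vars_compose2) auto
  hence "(\<integral>\<^sup>+\<omega>. (\<Prod>q\<in>?J. ?X q \<omega>) \<partial>M) = (\<Prod>q\<in>?J. \<integral>\<^sup>+\<omega>. ?X q \<omega> \<partial>M)"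
    using finite_Obl by (intro indep_vars_nn_integral) auto
  also have "\<dots> = (\<Prod>q\<in>?J. case q of (A, i) \<Rightarrow> ennreal (exposure_pgf A z))"
    using z by (intro prod.cong) (auto simp: nn_integral_pow_Copy)
  also have "\<dots> = (\<Prod>A\<in>Obl. \<Prod>i=1..d A. ennreal (exposure_pgf A z))"
    using finite_Obl by (subst prod.Sigma) auto
  also have "\<dots> = (\<Prod>A\<in>Obl. ennreal (exposure_pgf A z ^ d A))"
    using exposure_pgf_nonneg[OF z(1)] by (simp add: ennreal_power)
  finally have "(\<integral>\<^sup>+\<omega>. (\<Prod>q\<in>?J. ?X q \<omega>) \<partial>M) = \<dots>" .
  moreover have "(\<Prod>q\<in>?J. ?X q \<omega>) = ennreal (z ^ (\<Sum>A\<in>Obl. \<Sum>i=1..d A. Copy A i \<omega>))" for \<omega>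
  proof -
    have "(\<Prod>q\<in>?J. ?X q \<omega>) = (\<Prod>(A, i)\<in>?J. ennreal (z ^ Copy A i \<omega>))"
      by (intro prod.cong) auto
    also have "\<dots> = (\<Prod>A\<in>Obl. \<Prod>i=1..d A. ennreal (z ^ Copy A i \<omega>))"
      using finite_Obl by (subst prod.Sigma) auto
    also have "\<dots> = ennreal (z ^ (\<Sum>A\<in>Obl. \<Sum>i=1..d A. Copy A i \<omega>))"
      using z by (simp add: prod_ennreal prod_nonneg power_sum)
    finally show ?thesis .
  qed
  ultimately show ?thesis
    by simp
qed

text \<open>On the event that the default vector is \<open>d\<close>, the loss is a function of the
  copies alone. These are independent of defaults and sectors, so the power of \<open>z\<close>
  factors out of the integral.\<close>

lemma nn_integral_defaults_eq_pow_loss: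
  assumes W [measurable]: "W \<in> borel_measurable (PiM {0..N} (\<lambda>_. borel))"
    and d: "d \<in> PiE Obl (\<lambda>_. UNIV)" and z: "0 \<le> z" "z \<le> 1"
  shows "(\<integral>\<^sup>+\<omega>. W (sectors \<omega>) * indicator {\<omega>. defaults \<omega> = d} \<omega> * ennreal (z ^ loss \<omega>) \<partial>M)
    = (\<integral>\<^sup>+\<omega>. W (sectors \<omega>) * indicator {\<omega>. defaults \<omega> = d} \<omega> \<partial>M) * (\<Prod>A\<in>Obl. ennreal (exposure_pgf A z ^ d A))"
proof -
  \<comment> \<open>\<open>?Y1\<close> depends on the array of copies only, \<open>?Y2\<close> on
    the pair of default vector and sector vector only: the two sides of the independence
    assumption.\<close>
  let ?Y1 = "\<lambda>c. ennreal (z ^ (\<Sum>A\<in>Obl. \<Sum>i=1..d A. c (A, i)))"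
  let ?Y2 = "\<lambda>q. W (snd q) * indicator {d} (fst q)"
  let ?X1 = "\<lambda>\<omega>. \<lambda>(A, i)\<in>Obl \<times> {1..}. Copy A i \<omega>"
  let ?X2 = "\<lambda>\<omega>. (defaults \<omega>, sectors \<omega>)"
  have X1: "?Y1 (?X1 \<omega>) = ennreal (z ^ (\<Sum>A\<in>Obl. \<Sum>i=1..d A. Copy A i \<omega>))" for \<omega>
    by (intro arg_cong[where f=ennreal] arg_cong[where f="\<lambda>n. z ^ n"] sum.cong) auto
  have "(\<lambda>c. \<Sum>A\<in>Obl. \<Sum>i=1..d A. c (A, i) :: nat) \<in>
      measurable (PiM (Obl \<times> {1..}) (\<lambda>_. count_space UNIV)) (count_space UNIV)"
    by (intro measurable_sum_nat measurable_component_singleton) auto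
  hence Y1: "?Y1 \<in> borel_measurable (PiM (Obl \<times> {1..}) (\<lambda>_. count_space UNIV))"
    by (rule measurable_compose) simp
  have Y2: "?Y2 \<in> borel_measurable (count_space (PiE Obl (\<lambda>_. UNIV)) \<Otimes>\<^sub>M PiM {0..N} (\<lambda>_. borel))"
    by (intro borel_measurable_times_ennreal measurable_compose[OF measurable_snd W]
        measurable_compose[OF measurable_fst]) simp
  define F where "F = vimage_algebra (space M) ?X1 (PiM (Obl \<times> {1..}) (\<lambda>_. count_space UNIV))"
  define G where "G = vimage_algebra (space M) ?X2 (count_space (PiE Obl (\<lambda>_. UNIV)) \<Otimes>\<^sub>M PiM {0..N} (\<lambda>_. borel))"
  have "?X1 \<in> measurable F (PiM (Obl \<times> {1..}) (\<lambda>_. count_space UNIV))"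
    unfolding F_def by (intro measurable_vimage_algebra1) (auto simp: space_PiM)
  note F_meas = measurable_compose[OF this Y1]
  have "?X2 \<in> measurable G (count_space (PiE Obl (\<lambda>_. UNIV)) \<Otimes>\<^sub>M PiM {0..N} (\<lambda>_. borel))"
    unfolding G_def
    by (intro measurable_vimage_algebra1) (auto simp: space_PiM space_pair_measure defaults_def sectors_def)
  note G_meas = measurable_compose[OF this Y2]
  have "indep_set (sets F) (sets G)"
    using Copy_indep_D_S
    unfolding F_def G_def PiM_Obl_eq_count_space defaults_def sectors_def .
  hence "indep_var borel (\<lambda>\<omega>. ?Y1 (?X1 \<omega>)) borel (\<lambda>\<omega>. ?Y2 (?X2 \<omega>))"
    by (rule indep_var_if_indep_set[OF _ F_meas G_meas]) (simp_all add: F_def G_def)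
  from indep_var_nn_integral[OF this]
  have "(\<integral>\<^sup>+\<omega>. ?Y1 (?X1 \<omega>) * (W (sectors \<omega>) * indicator {\<omega>. defaults \<omega> = d} \<omega>) \<partial>M)
    = (\<integral>\<^sup>+\<omega>. ?Y1 (?X1 \<omega>) \<partial>M) * (\<integral>\<^sup>+\<omega>. W (sectors \<omega>) * indicator {\<omega>. defaults \<omega> = d} \<omega> \<partial>M)"
    by (simp add: indicator_def)
  also have "(\<integral>\<^sup>+\<omega>. ?Y1 (?X1 \<omega>) \<partial>M) = (\<Prod>A\<in>Obl. ennreal (exposure_pgf A z ^ d A))"
    unfolding X1 using z by (rule nn_integral_pow_sum_Copy)
  also have "(\<integral>\<^sup>+\<omega>. ?Y1 (?X1 \<omega>) * (W (sectors \<omega>) * indicator {\<omega>. defaults \<omega> = d} \<omega>) \<partial>M)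
    = (\<integral>\<^sup>+\<omega>. W (sectors \<omega>) * indicator {\<omega>. defaults \<omega> = d} \<omega> * ennreal (z ^ loss \<omega>) \<partial>M)"
    unfolding X1
  proof (intro nn_integral_cong)
    fix \<omega>
    have "loss \<omega> = (\<Sum>A\<in>Obl. \<Sum>i=1..d A. Copy A i \<omega>)" if "defaults \<omega> = d"
      unfolding loss_def that[symmetric] by (intro sum.cong) (auto simp: defaults_def)
    thus "ennreal (z ^ (\<Sum>A\<in>Obl. \<Sum>i=1..d A. Copy A i \<omega>)) * (W (sectors \<omega>) * indicator {\<omega>. defaults \<omega> = d} \<omega>)
      = W (sectors \<omega>) * indicator {\<omega>. defaults \<omega> = d} \<omega> * ennreal (z ^ loss \<omega>)"
      by (auto simp: mult_ac split: split_indicator)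
  qed
  finally show ?thesis
    by (simp add: mult.commute)
qed

text \<open>The weight is measurable with respect to the sectors, so the event may be replaced by
  its conditional probability, which is a product of Poisson masses. Since
  \<open>cond_indep_vars\<close> speaks of nonempty index sets, \<open>Obl\<close> is taken
  nonempty.\<close>

lemma nn_integral_defaults_eq:
  assumes W [measurable]: "W \<in> borel_measurable (PiM {0..N} (\<lambda>_. borel))"
    and d: "d \<in> PiE Obl (\<lambda>_. UNIV)" and ne: "Obl \<noteq> {}"
  shows "(\<integral>\<^sup>+\<omega>. W (sectors \<omega>) * indicator {\<omega>. defaults \<omega> = d} \<omega> \<partial>M)
    = (\<integral>\<^sup>+\<omega>. W (sectors \<omega>) * (\<Prod>A\<in>Obl. ennreal (pmf (poisson_pmf (intensity A \<omega>)) (d A))) \<partial>M)"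
proof -
  define F where "F = vimage_algebra (space M) sectors (PiM {0..N} (\<lambda>_. borel))"
  have sub: "subalgebra M F"
    unfolding subalgebra_def F_def
    using sets_image_in_sets[OF refl sectors_measurable] by simp
  interpret finite_measure_subalgebra M F
    by (simp add: finite_measure_subalgebra_def finite_measure_subalgebra_axioms_def sub finite_measure_axioms)
  interpret sigma_finite_subalgebra M F
    by (rule finite_measure_subalgebra_is_sigma_finite) unfold_locales
  have sec: "sectors \<in> measurable F (PiM {0..N} (\<lambda>_. borel))"
    unfolding F_def using measurable_space[OF sectors_measurable]
    by (intro measurable_vimage_algebra1) auto
  let ?E = "{\<omega> \<in> space M. \<forall>A\<in>Obl. D A \<omega> \<in> {d A}}"
  have E: "?E \<in> sets M"
  proof (rule sets.sets_Collect_finite_All'[OF _ finite_Obl ne])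
    fix A assume "A \<in> Obl"
    from measurable_sets[OF D_measurable[OF this], of "{d A}"]
    show "{\<omega> \<in> space M. D A \<omega> \<in> {d A}} \<in> sets M"
      by (simp add: vimage_def Int_def conj_commute)
  qed
  have eq: "indicator {\<omega>. defaults \<omega> = d} \<omega> = ennreal (indicator ?E \<omega>)" if "\<omega> \<in> space M" for \<omega>
  proof -
    have "defaults \<omega> = d \<longleftrightarrow> (\<forall>A\<in>Obl. D A \<omega> = d A)"
      using d by (auto simp: defaults_def fun_eq_iff PiE_def extensional_def restrict_def)
    thus ?thesis
      using that by (auto simp: indicator_def)
  qed
  have "AE \<omega> in M. real_cond_exp M F (indicator ?E) \<omega> =
      (\<Prod>A\<in>Obl. real_cond_exp M F (indicator {\<omega> \<in> space M. D A \<omega> \<in> {d A}}) \<omega>)"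
    using D_cond_indep finite_Obl ne
    unfolding cond_indep_vars_def F_def sectors_def
    by (elim conjE allE[of _ Obl] allE[of _ "\<lambda>A. {d A}"]) simp
  moreover have "AE \<omega> in M. \<forall>A\<in>Obl. real_cond_exp M F (indicator {\<omega> \<in> space M. D A \<omega> \<in> {d A}}) \<omega> =
      pmf (poisson_pmf (intensity A \<omega>)) (d A)"
    using D_cond_poisson finite_Obl
    unfolding F_def sectors_def intensity_def by (intro AE_finite_allI) auto
  moreover have "AE \<omega> in M. nn_cond_exp M F (\<lambda>\<omega>. ennreal (indicator ?E \<omega>)) \<omega> = ennreal (real_cond_exp M F (indicator ?E) \<omega>)"
    using E by (intro nn_cond_exp_eq_real_cond_exp) (auto split: split_indicator)
  ultimately have ae: "AE \<omega> in M. nn_cond_exp M F (\<lambda>\<omega>. ennreal (indicator ?E \<omega>)) \<omega> =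
      (\<Prod>A\<in>Obl. ennreal (pmf (poisson_pmf (intensity A \<omega>)) (d A)))"
    by eventually_elim (simp add: prod_ennreal)
  have "(\<integral>\<^sup>+\<omega>. W (sectors \<omega>) * indicator {\<omega>. defaults \<omega> = d} \<omega> \<partial>M)
      = (\<integral>\<^sup>+\<omega>. W (sectors \<omega>) * ennreal (indicator ?E \<omega>) \<partial>M)"
    by (intro nn_integral_cong) (simp add: eq)
  also have "\<dots> = (\<integral>\<^sup>+\<omega>. W (sectors \<omega>) * nn_cond_exp M F (\<lambda>\<omega>. ennreal (indicator ?E \<omega>)) \<omega> \<partial>M)"
    using E by (intro nn_cond_exp_intg[symmetric] measurable_compose[OF sec]) auto
  also have "\<dots> = (\<integral>\<^sup>+\<omega>. W (sectors \<omega>) * (\<Prod>A\<in>Obl. ennreal (pmf (poisson_pmf (intensity A \<omega>)) (d A))) \<partial>M)"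
    using ae by (intro nn_integral_cong_AE) (auto elim!: eventually_mono)
  finally show ?thesis .
qed

lemma loss_eq_measurable [measurable]:
  "(\<lambda>\<omega>. indicator {\<omega>. loss \<omega> = m} \<omega> :: ennreal) \<in> borel_measurable M"
  using measurable_compose[OF loss_measurable, of "indicator {m} :: nat \<Rightarrow> ennreal" borel]
  by (simp add: indicator_def)

text \<open>Makes the integral a power series in \<open>z\<close> whose coefficients live on the
  events that the loss equals \<open>m\<close>. Comparing coefficients thus yields statements
  restricted to these events.\<close>

lemma nn_integral_pow_loss_fiber:
  fixes f :: "'w \<Rightarrow> ennreal"
  assumes f [measurable]: "f \<in> borel_measurable M"
  shows "(\<integral>\<^sup>+\<omega>. f \<omega> * ennreal (z ^ loss \<omega>) \<partial>M)
    = (\<integral>\<^sup>+m. (\<integral>\<^sup>+\<omega>. f \<omega> * indicator {\<omega>. loss \<omega> = m} \<omega> \<partial>M) * ennreal (z ^ m) \<partial>count_space UNIV)"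
proof -
  have "(\<integral>\<^sup>+\<omega>. f \<omega> * ennreal (z ^ loss \<omega>) \<partial>M) =
      (\<integral>\<^sup>+m. (\<integral>\<^sup>+\<omega>. f \<omega> * ennreal (z ^ loss \<omega>) * indicator {\<omega>. loss \<omega> = m} \<omega> \<partial>M) \<partial>count_space UNIV)"
    by (intro nn_integral_eq_nn_integral_fiber borel_measurable_times_ennreal f
        measurable_compose[OF loss_measurable, of "\<lambda>m. ennreal (z ^ m)"]) auto
  also have "\<dots> = (\<integral>\<^sup>+m. (\<integral>\<^sup>+\<omega>. f \<omega> * indicator {\<omega>. loss \<omega> = m} \<omega> \<partial>M) * ennreal (z ^ m) \<partial>count_space UNIV)"
  proof (rule nn_integral_cong)
    fix m
    have "(\<integral>\<^sup>+\<omega>. f \<omega> * ennreal (z ^ loss \<omega>) * indicator {\<omega>. loss \<omega> = m} \<omega> \<partial>M)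
      = (\<integral>\<^sup>+\<omega>. f \<omega> * indicator {\<omega>. loss \<omega> = m} \<omega> * ennreal (z ^ m) \<partial>M)"
      by (rule nn_integral_cong) (auto split: split_indicator)
    also have "\<dots> = (\<integral>\<^sup>+\<omega>. f \<omega> * indicator {\<omega>. loss \<omega> = m} \<omega> \<partial>M) * ennreal (z ^ m)"
      by (rule nn_integral_multc) measurable
    finally show "(\<integral>\<^sup>+\<omega>. f \<omega> * ennreal (z ^ loss \<omega>) * indicator {\<omega>. loss \<omega> = m} \<omega> \<partial>M) = \<dots>" .
  qed
  finally show ?thesis .
qed

section \<open>Almost sure positivity, and integrating out the default counts\<close>

lemma S_pos: "AE \<omega> in M. \<forall>k\<in>{1..N}. 0 < S k \<omega>"
proof (rule AE_finite_allI)
  fix k assume k: "k \<in> {1..N}"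
  have "emeasure M (S k -` {..0} \<inter> space M) =
      (\<integral>\<^sup>+y. ennreal (gamma_density (\<alpha> k) (1 / \<alpha> k) y) * indicator {..0} y \<partial>lborel)"
    by (rule distributed_emeasure[OF S_gamma[OF k]]) simp
  also have "\<dots> = (\<integral>\<^sup>+y. 0 \<partial>(lborel :: real measure))"
    by (intro nn_integral_cong) (auto simp: gamma_density_def split: split_indicator)
  finally have "emeasure M (S k -` {..0} \<inter> space M) = 0"
    by simp
  moreover have "S k -` {..0} \<inter> space M \<in> sets M"
    using k by (intro measurable_sets[OF S_measurable]) auto
  ultimately show "AE \<omega> in M. 0 < S k \<omega>"
    by (intro AE_I[where N="S k -` {..0} \<inter> space M"]) auto
qed simp

lemma S_nonneg: "AE \<omega> in M. \<forall>k\<in>{0..N}. 0 \<le> S k \<omega>"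
  using S_pos AE_space
proof eventually_elim
  case (elim \<omega>)
  show ?case
  proof
    fix k assume "k \<in> {0..N}"
    thus "0 \<le> S k \<omega>"
      using elim S_0 by (cases "k = 0") (auto intro: less_imp_le)
  qed
qed

text \<open>The weights of an obligor sum to 1, so one of them is positive, and the corresponding
  sector is almost surely positive.\<close>

lemma intensity_pos: "AE \<omega> in M. \<forall>A\<in>Obl. 0 < intensity A \<omega>"
  using S_pos AE_space
proof eventually_elim
  case (elim \<omega>)
  show ?case
  proof
    fix A assume A: "A \<in> Obl"
    have pos: "0 < S k \<omega>" if "k \<in> {0..N}" for k
      using elim S_0 that by (cases "k = 0") auto
    have "\<exists>k\<in>{0..N}. w A k \<noteq> 0"
      using w_sum[OF A] by (metis sum.neutral zero_neq_one)
    then obtain k where k: "k \<in> {0..N}" "0 < w A k"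
      using w_bounds[OF A] by (metis less_eq_real_def)
    have "0 < (\<Sum>k=0..N. w A k * S k \<omega>)"
      using k pos w_bounds[OF A] by (intro sum_pos2[OF _ k(1)]) (auto intro!: mult_nonneg_nonneg less_imp_le[OF pos])
    thus "0 < intensity A \<omega>"
      using p_pos[OF A] by (simp add: intensity_def)
  qed
qed

text \<open>The factors \<open>g A\<close> leave room for a function of each default count:
  constantly 1 for the plain transform, the count itself for the two obligors of the mixed
  moment.\<close>

lemma nn_integral_pow_loss:
  assumes W [measurable]: "W \<in> borel_measurable (PiM {0..N} (\<lambda>_. borel))"
    and z: "0 \<le> z" "z \<le> 1" and ne: "Obl \<noteq> {}"
  shows "(\<integral>\<^sup>+\<omega>. W (sectors \<omega>) * (\<Prod>A\<in>Obl. g A (D A \<omega>)) * ennreal (z ^ loss \<omega>) \<partial>M)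
    = (\<integral>\<^sup>+\<omega>. W (sectors \<omega>) * (\<Prod>A\<in>Obl. \<integral>\<^sup>+n. g A n * ennreal (exposure_pgf A z ^ n) *
         ennreal (pmf (poisson_pmf (intensity A \<omega>)) n) \<partial>count_space UNIV) \<partial>M)"
    (is "?L = ?R")
proof -
  let ?C = "PiE Obl (\<lambda>_. UNIV :: nat set)"
  let ?h = "\<lambda>A. exposure_pgf A z"
  let ?pois = "\<lambda>A \<omega> n. ennreal (pmf (poisson_pmf (intensity A \<omega>)) n)"
  have W_sec [measurable]: "(\<lambda>\<omega>. W (sectors \<omega>)) \<in> borel_measurable M"
    by (rule measurable_compose[OF sectors_measurable W])
  have g_meas [measurable]: "(\<lambda>\<omega>. g A (D A \<omega>)) \<in> borel_measurable M" if "A \<in> Obl" for A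
    by (rule measurable_compose[OF D_measurable[OF that]]) simp
  have int_meas [measurable]: "intensity A \<in> borel_measurable M" for A
    unfolding intensity_def by (intro borel_measurable_times borel_measurable_sum) auto
  have z_meas [measurable]: "(\<lambda>\<omega>. ennreal (z ^ loss \<omega>)) \<in> borel_measurable M"
    by (rule measurable_compose[OF loss_measurable]) simp
  \<comment> \<open>The explicit formula agrees almost surely with the Poisson mass and is visibly
    measurable in \<omega>, also where the intensity is not positive and \<open>poisson_pmf\<close>
    is unspecified.\<close>
  have pois_ae: "AE \<omega> in M. \<forall>A\<in>Obl. \<forall>n. ?pois A \<omega> n =
      ennreal (intensity A \<omega> ^ n / fact n * exp (- intensity A \<omega>))"
    using intensity_pos by eventually_elim auto
  let ?q = "\<lambda>A \<omega> n. ennreal (intensity A \<omega> ^ n / fact n * exp (- intensity A \<omega>))"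
  have "?L = (\<integral>\<^sup>+d. (\<integral>\<^sup>+\<omega>. W (sectors \<omega>) * (\<Prod>A\<in>Obl. g A (D A \<omega>)) * ennreal (z ^ loss \<omega>) *
      indicator {\<omega>. defaults \<omega> = d} \<omega> \<partial>M) \<partial>count_space ?C)"
    using countable_PiE_Obl defaults_in_PiE
    by (intro nn_integral_eq_nn_integral_fiber borel_measurable_times_ennreal borel_measurable_prod_ennreal)
       (auto intro: g_meas)
  also have "\<dots> = (\<integral>\<^sup>+d. (\<integral>\<^sup>+\<omega>. W (sectors \<omega>) *
      (\<Prod>A\<in>Obl. g A (d A) * ennreal (?h A ^ d A) * ?q A \<omega> (d A)) \<partial>M) \<partial>count_space ?C)"
  proof (rule nn_integral_cong)
    fix d assume "d \<in> space (count_space ?C)"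
    hence d: "d \<in> ?C"
      by simp
    let ?c = "\<Prod>A\<in>Obl. g A (d A)" and ?H = "\<Prod>A\<in>Obl. ennreal (?h A ^ d A)"
    have [measurable]: "(\<lambda>\<omega>. indicator {\<omega>. defaults \<omega> = d} \<omega> :: ennreal) \<in> borel_measurable M"
      by (rule defaults_eq_measurable[OF d])
    have "(\<integral>\<^sup>+\<omega>. W (sectors \<omega>) * (\<Prod>A\<in>Obl. g A (D A \<omega>)) * ennreal (z ^ loss \<omega>) *
        indicator {\<omega>. defaults \<omega> = d} \<omega> \<partial>M)
      = (\<integral>\<^sup>+\<omega>. ?c * (W (sectors \<omega>) * indicator {\<omega>. defaults \<omega> = d} \<omega> * ennreal (z ^ loss \<omega>)) \<partial>M)"
    proof (intro nn_integral_cong)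
      fix \<omega>
      have "(\<Prod>A\<in>Obl. g A (D A \<omega>)) = ?c" if "defaults \<omega> = d"
        unfolding that[symmetric] by (intro prod.cong) (auto simp: defaults_def)
      thus "W (sectors \<omega>) * (\<Prod>A\<in>Obl. g A (D A \<omega>)) * ennreal (z ^ loss \<omega>) * indicator {\<omega>. defaults \<omega> = d} \<omega>
        = ?c * (W (sectors \<omega>) * indicator {\<omega>. defaults \<omega> = d} \<omega> * ennreal (z ^ loss \<omega>))"
        by (auto simp: mult_ac split: split_indicator)
    qed
    also have "\<dots> = ?c * (?H * (\<integral>\<^sup>+\<omega>. W (sectors \<omega>) * indicator {\<omega>. defaults \<omega> = d} \<omega> \<partial>M))"
      by (subst nn_integral_cmult, measurable)
         (subst nn_integral_defaults_eq_pow_loss[OF W d z], simp add: mult.commute)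
    also have "(\<integral>\<^sup>+\<omega>. W (sectors \<omega>) * indicator {\<omega>. defaults \<omega> = d} \<omega> \<partial>M)
      = (\<integral>\<^sup>+\<omega>. W (sectors \<omega>) * (\<Prod>A\<in>Obl. ?pois A \<omega> (d A)) \<partial>M)"
      by (rule nn_integral_defaults_eq[OF W d ne])
    also have "\<dots> = (\<integral>\<^sup>+\<omega>. W (sectors \<omega>) * (\<Prod>A\<in>Obl. ?q A \<omega> (d A)) \<partial>M)"
      using pois_ae by (intro nn_integral_cong_AE) (auto elim!: eventually_mono)
    also have "?c * (?H * \<dots>) = (\<integral>\<^sup>+\<omega>. (?c * ?H) * (W (sectors \<omega>) * (\<Prod>A\<in>Obl. ?q A \<omega> (d A))) \<partial>M)"
      by (subst nn_integral_cmult) (auto simp: mult.assoc)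
    also have "\<dots> = (\<integral>\<^sup>+\<omega>. W (sectors \<omega>) *
      (\<Prod>A\<in>Obl. g A (d A) * ennreal (?h A ^ d A) * ?q A \<omega> (d A)) \<partial>M)"
      by (intro nn_integral_cong) (simp add: prod.distrib mult_ac)
    finally show "(\<integral>\<^sup>+\<omega>. W (sectors \<omega>) * (\<Prod>A\<in>Obl. g A (D A \<omega>)) * ennreal (z ^ loss \<omega>) *
        indicator {\<omega>. defaults \<omega> = d} \<omega> \<partial>M) = \<dots>" .
  qed
  also have "\<dots> = (\<integral>\<^sup>+\<omega>. (\<integral>\<^sup>+d. W (sectors \<omega>) *
      (\<Prod>A\<in>Obl. g A (d A) * ennreal (?h A ^ d A) * ?q A \<omega> (d A)) \<partial>count_space ?C) \<partial>M)"
    by (rule nn_integral_count_space_nn_integral[OF countable_PiE_Obl, symmetric]) measurable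
  \<comment> \<open>A sum over all default vectors of a product over obligors is the product of the
    single sums; this is Fubini for a finite product of counting measures.\<close>
  also have "\<dots> = (\<integral>\<^sup>+\<omega>. W (sectors \<omega>) *
      (\<Prod>A\<in>Obl. \<integral>\<^sup>+n. g A n * ennreal (?h A ^ n) * ?q A \<omega> n \<partial>count_space UNIV) \<partial>M)"
  proof (intro nn_integral_cong)
    fix \<omega>
    interpret product_sigma_finite "\<lambda>_::'o. count_space (UNIV :: nat set)"
      by (intro product_sigma_finite.intro sigma_finite_measure_count_space_countable) simp
    show "(\<integral>\<^sup>+d. W (sectors \<omega>) *
      (\<Prod>A\<in>Obl. g A (d A) * ennreal (?h A ^ d A) * ?q A \<omega> (d A)) \<partial>count_space ?C)
      = W (sectors \<omega>) *
      (\<Prod>A\<in>Obl. \<integral>\<^sup>+n. g A n * ennreal (?h A ^ n) * ?q A \<omega> n \<partial>count_space UNIV)"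
      using product_nn_integral_prod[OF finite_Obl, of "\<lambda>A n. g A n * ennreal (?h A ^ n) * ?q A \<omega> n"]
      unfolding PiM_Obl_eq_count_space by (subst nn_integral_cmult) auto
  qed
  also have "\<dots> = ?R"
    using pois_ae by (intro nn_integral_cong_AE) (auto elim!: eventually_mono)
  finally show ?thesis .
qed

text \<open>For \<open>z\<close> in [0,1] this is the conditional generating function of the loss
  given the sectors, that of a compound Poisson sum.\<close>

definition loss_kernel :: "real \<Rightarrow> 'w \<Rightarrow> real" where
  "loss_kernel z \<omega> = exp (\<Sum>A\<in>Obl. intensity A \<omega> * (exposure_pgf A z - 1))"

lemma nn_integral_weight_pow_loss:
  assumes W: "W \<in> borel_measurable (PiM {0..N} (\<lambda>_. borel))"
    and z: "0 \<le> z" "z \<le> 1" and ne: "Obl \<noteq> {}"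
  shows "(\<integral>\<^sup>+\<omega>. W (sectors \<omega>) * ennreal (z ^ loss \<omega>) \<partial>M)
    = (\<integral>\<^sup>+\<omega>. W (sectors \<omega>) * ennreal (loss_kernel z \<omega>) \<partial>M)"
proof -
  have "(\<integral>\<^sup>+\<omega>. W (sectors \<omega>) * ennreal (z ^ loss \<omega>) \<partial>M)
    = (\<integral>\<^sup>+\<omega>. W (sectors \<omega>) * (\<Prod>A\<in>Obl. \<integral>\<^sup>+n. 1 * ennreal (exposure_pgf A z ^ n) *
         ennreal (pmf (poisson_pmf (intensity A \<omega>)) n) \<partial>count_space UNIV) \<partial>M)"
    using nn_integral_pow_loss[OF W z ne, of "\<lambda>_ _. 1"] by simp
  also have "\<dots> = (\<integral>\<^sup>+\<omega>. W (sectors \<omega>) * ennreal (loss_kernel z \<omega>) \<partial>M)"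
  proof (intro nn_integral_cong_AE)
    show "AE \<omega> in M. W (sectors \<omega>) * (\<Prod>A\<in>Obl. \<integral>\<^sup>+n. 1 * ennreal (exposure_pgf A z ^ n) *
         ennreal (pmf (poisson_pmf (intensity A \<omega>)) n) \<partial>count_space UNIV)
       = W (sectors \<omega>) * ennreal (loss_kernel z \<omega>)"
      using intensity_pos
    proof eventually_elim
      case (elim \<omega>)
      hence "(\<Prod>A\<in>Obl. \<integral>\<^sup>+n. 1 * ennreal (exposure_pgf A z ^ n) *
         ennreal (pmf (poisson_pmf (intensity A \<omega>)) n) \<partial>count_space UNIV)
        = (\<Prod>A\<in>Obl. ennreal (exp (intensity A \<omega> * (exposure_pgf A z - 1))))"
        using nn_integral_poisson_pgf exposure_pgf_nonneg[OF z(1)] by (intro prod.cong) auto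
      thus ?case
        by (simp add: loss_kernel_def exp_sum finite_Obl prod_ennreal)
    qed
  qed
  finally show ?thesis .
qed

text \<open>Relative to the plain transform, a counted default contributes the factor l h. As the
  obligors differ, each contributes one such factor; the constants h leave the integral while the
  intensities remain as a weight.\<close>

lemma nn_integral_D_D_pow_loss:
  assumes A1: "A1 \<in> Obl" and A2: "A2 \<in> Obl" and distinct: "A1 \<noteq> A2"
    and z: "0 \<le> z" "z \<le> 1"
  shows "(\<integral>\<^sup>+\<omega>. ennreal (real (D A1 \<omega>) * real (D A2 \<omega>)) * ennreal (z ^ loss \<omega>) \<partial>M)
    = ennreal (exposure_pgf A1 z * exposure_pgf A2 z) *
      (\<integral>\<^sup>+\<omega>. ennreal (intensity A1 \<omega> * intensity A2 \<omega>) * ennreal (z ^ loss \<omega>) \<partial>M)"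
proof -
  let ?h = "\<lambda>A. exposure_pgf A z"
  let ?g = "\<lambda>A n. if A = A1 \<or> A = A2 then ennreal (real n) else 1"
  have ne: "Obl \<noteq> {}"
    using A1 by auto
  have prod12: "(\<Prod>A\<in>Obl. if A = A1 \<or> A = A2 then f A else 1) = f A1 * f A2" for f :: "'o \<Rightarrow> ennreal"
  proof -
    have "(\<Prod>A\<in>Obl. if A = A1 \<or> A = A2 then f A else 1) = (\<Prod>A\<in>{A1, A2}. f A)"
      using A1 A2 finite_Obl by (intro prod.mono_neutral_cong_right) auto
    thus ?thesis
      using distinct by simp
  qed
  have h: "0 \<le> ?h A" for A
    by (rule exposure_pgf_nonneg[OF z(1)])
  let ?W = "\<lambda>s. ennreal ((p A1 * (\<Sum>k=0..N. w A1 k * s k)) * (p A2 * (\<Sum>k=0..N. w A2 k * s k)))"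
  have W: "?W \<in> borel_measurable (PiM {0..N} (\<lambda>_. borel))"
    by measurable
  have W_sec: "?W (sectors \<omega>) = ennreal (intensity A1 \<omega> * intensity A2 \<omega>)" for \<omega>
    by (simp add: intensity_def sectors_def)
  have "(\<integral>\<^sup>+\<omega>. ennreal (real (D A1 \<omega>) * real (D A2 \<omega>)) * ennreal (z ^ loss \<omega>) \<partial>M)
    = (\<integral>\<^sup>+\<omega>. 1 * (\<Prod>A\<in>Obl. ?g A (D A \<omega>)) * ennreal (z ^ loss \<omega>) \<partial>M)"
    by (simp add: prod12 ennreal_mult)
  also have "\<dots> = (\<integral>\<^sup>+\<omega>. 1 * (\<Prod>A\<in>Obl. \<integral>\<^sup>+n. ?g A n * ennreal (?h A ^ n) *
         ennreal (pmf (poisson_pmf (intensity A \<omega>)) n) \<partial>count_space UNIV) \<partial>M)"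
    by (rule nn_integral_pow_loss[OF _ z ne]) simp
  also have "\<dots> = (\<integral>\<^sup>+\<omega>. ennreal (?h A1 * ?h A2) *
      (ennreal (intensity A1 \<omega> * intensity A2 \<omega>) * ennreal (loss_kernel z \<omega>)) \<partial>M)"
  proof (intro nn_integral_cong_AE)
    show "AE \<omega> in M. 1 * (\<Prod>A\<in>Obl. \<integral>\<^sup>+n. ?g A n * ennreal (?h A ^ n) *
         ennreal (pmf (poisson_pmf (intensity A \<omega>)) n) \<partial>count_space UNIV)
       = ennreal (?h A1 * ?h A2) * (ennreal (intensity A1 \<omega> * intensity A2 \<omega>) * ennreal (loss_kernel z \<omega>))"
      using intensity_pos
    proof eventually_elim
      case (elim \<omega>)
      have "(\<Prod>A\<in>Obl. \<integral>\<^sup>+n. ?g A n * ennreal (?h A ^ n) *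
         ennreal (pmf (poisson_pmf (intensity A \<omega>)) n) \<partial>count_space UNIV)
        = (\<Prod>A\<in>Obl. (if A = A1 \<or> A = A2 then ennreal (intensity A \<omega> * ?h A) else 1) *
             ennreal (exp (intensity A \<omega> * (?h A - 1))))"
      proof (intro prod.cong refl)
        fix A assume A: "A \<in> Obl"
        hence l: "0 < intensity A \<omega>"
          using elim by auto
        show "(\<integral>\<^sup>+n. ?g A n * ennreal (?h A ^ n) * ennreal (pmf (poisson_pmf (intensity A \<omega>)) n) \<partial>count_space UNIV)
          = (if A = A1 \<or> A = A2 then ennreal (intensity A \<omega> * ?h A) else 1) *
             ennreal (exp (intensity A \<omega> * (?h A - 1)))"
        proof (cases "A = A1 \<or> A = A2")
          case True
          thus ?thesis
            using nn_integral_poisson_pgf_deriv[OF l h] l h by (simp add: ennreal_mult')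
        next
          case False
          thus ?thesis
            using nn_integral_poisson_pgf[OF l h] by simp
        qed
      qed
      also have "\<dots> = (ennreal (intensity A1 \<omega> * ?h A1) * ennreal (intensity A2 \<omega> * ?h A2)) * ennreal (loss_kernel z \<omega>)"
        by (simp add: prod.distrib prod12 loss_kernel_def exp_sum finite_Obl prod_ennreal)
      also have "\<dots> = ennreal (?h A1 * ?h A2) * (ennreal (intensity A1 \<omega> * intensity A2 \<omega>) * ennreal (loss_kernel z \<omega>))"
        using elim A1 A2 h by (simp add: ennreal_mult less_imp_le mult_ac)
      finally show ?case
        by simp
    qed
  qed
  also have "\<dots> = ennreal (?h A1 * ?h A2) *
      (\<integral>\<^sup>+\<omega>. ?W (sectors \<omega>) * ennreal (loss_kernel z \<omega>) \<partial>M)"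
    unfolding W_sec loss_kernel_def intensity_def by (rule nn_integral_cmult) measurable
  \<comment> \<open>The weighted transform is used from right to left: the conditional kernel
    becomes a power of \<open>z\<close> again, now with the product of intensities as
    weight.\<close>
  also have "\<dots> = ennreal (?h A1 * ?h A2) * (\<integral>\<^sup>+\<omega>. ?W (sectors \<omega>) * ennreal (z ^ loss \<omega>) \<partial>M)"
    by (subst nn_integral_weight_pow_loss[OF W z ne]) simp
  finally show ?thesis
    unfolding W_sec .
qed

section \<open>The shifted loss laws\<close>

text \<open>Integrating out sector \<open>k\<close> evaluates its Laplace transform at this point, the paper's \<open>\<mu>\<^sub>k (1 - \<Q>\<^sub>k(z))\<close>.\<close>

definition laplace_arg :: "nat \<Rightarrow> real \<Rightarrow> real" where
  "laplace_arg k z = (\<Sum>A\<in>Obl. w A k * p A * (1 - exposure_pgf A z))"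

text \<open>The mixed moment E[S_1^(r 1) ... S_N^(r N)] of the independent Gamma sectors, the
  normalising constant of the weighted law.\<close>

definition moment :: "(nat \<Rightarrow> nat) \<Rightarrow> real" where
  "moment r = (\<Prod>k=1..N. Gamma (\<alpha> k + real (r k)) / (Gamma (\<alpha> k) * \<alpha> k ^ r k))"

lemma moment_pos: "0 < moment r"
  unfolding moment_def using \<alpha>_pos by (intro prod_pos) (auto intro!: divide_pos_pos mult_pos_pos Gamma_real_pos add_pos_nonneg)

lemma laplace_arg_nonneg:
  assumes "0 \<le> z" "z \<le> 1" "k \<in> {0..N}"
  shows "0 \<le> laplace_arg k z"
  unfolding laplace_arg_def
  using assms w_bounds exposure_pgf_le_1 p_pos
  by (intro sum_nonneg mult_nonneg_nonneg) (auto intro: less_imp_le)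

text \<open>The exponent is linear in the sectors, so exchanging the sums over obligors and sectors
  separates them; \<open>S 0 = 1\<close> leaves the deterministic factor.\<close>

lemma loss_kernel_eq:
  assumes "\<omega> \<in> space M"
  shows "loss_kernel z \<omega> = exp (- laplace_arg 0 z) * (\<Prod>k=1..N. exp (- laplace_arg k z * S k \<omega>))"
proof -
  have "(\<Sum>A\<in>Obl. intensity A \<omega> * (exposure_pgf A z - 1))
      = (\<Sum>A\<in>Obl. \<Sum>k=0..N. - (w A k * p A * (1 - exposure_pgf A z) * S k \<omega>))"
    unfolding intensity_def by (simp add: sum_distrib_left sum_distrib_right algebra_simps)
  also have "\<dots> = (\<Sum>k=0..N. - laplace_arg k z * S k \<omega>)"
    by (subst sum.swap) (simp add: laplace_arg_def sum_distrib_right sum_negf)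
  also have "\<dots> = - laplace_arg 0 z * S 0 \<omega> + (\<Sum>k=1..N. - laplace_arg k z * S k \<omega>)"
    by (simp add: sum.atLeast_Suc_atMost)
  finally show ?thesis
    unfolding loss_kernel_def S_0[OF assms] by (simp only: exp_add exp_sum[OF finite_atLeastAtMost] mult_1_right)
qed

text \<open>Independence of the sectors reduces this to one Gamma integral per sector. Apart from
  \<open>moment r\<close>, the right-hand side is \<open>loss_gf\<close> at the real point
  \<open>z\<close> with the exponents \<alpha> + r.\<close>

lemma nn_integral_moment_pow_loss:
  assumes z: "0 \<le> z" "z \<le> 1" and ne: "Obl \<noteq> {}"
  shows "(\<integral>\<^sup>+\<omega>. ennreal (\<Prod>k=1..N. S k \<omega> ^ r k) * ennreal (z ^ loss \<omega>) \<partial>M)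
    = ennreal (moment r * (exp (- laplace_arg 0 z) *
        (\<Prod>k=1..N. (1 / (1 + 1 / \<alpha> k * laplace_arg k z)) powr (\<alpha> k + real (r k)))))"
proof -
  let ?W = "\<lambda>s. ennreal (\<Prod>k=1..N. s k ^ r k)"
  let ?X = "\<lambda>k y. ennreal (y ^ r k * exp (- laplace_arg k z * y))"
  let ?m = "\<lambda>k. Gamma (\<alpha> k + real (r k)) / (Gamma (\<alpha> k) * \<alpha> k ^ r k) *
    (1 / (1 + 1 / \<alpha> k * laplace_arg k z)) powr (\<alpha> k + real (r k))"
  have W: "?W \<in> borel_measurable (PiM {0..N} (\<lambda>_. borel))"
    by (intro measurable_compose[OF borel_measurable_prod measurable_ennreal] borel_measurable_power
        measurable_component_singleton) auto
  have W_sec: "?W (sectors \<omega>) = ennreal (\<Prod>k=1..N. S k \<omega> ^ r k)" for \<omega>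
    by (intro arg_cong[where f=ennreal] prod.cong) (auto simp: sectors_def)
  have "(\<integral>\<^sup>+\<omega>. ennreal (\<Prod>k=1..N. S k \<omega> ^ r k) * ennreal (z ^ loss \<omega>) \<partial>M)
    = (\<integral>\<^sup>+\<omega>. ennreal (\<Prod>k=1..N. S k \<omega> ^ r k) * ennreal (loss_kernel z \<omega>) \<partial>M)"
    using nn_integral_weight_pow_loss[OF W z ne] unfolding W_sec .
  also have "\<dots> = (\<integral>\<^sup>+\<omega>. ennreal (exp (- laplace_arg 0 z)) * (\<Prod>k=1..N. ?X k (S k \<omega>)) \<partial>M)"
  proof (rule nn_integral_cong_AE)
    show "AE \<omega> in M. ennreal (\<Prod>k=1..N. S k \<omega> ^ r k) * ennreal (loss_kernel z \<omega>)
      = ennreal (exp (- laplace_arg 0 z)) * (\<Prod>k=1..N. ?X k (S k \<omega>))"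
      using S_pos AE_space
    proof eventually_elim
      case (elim \<omega>)
      hence S: "0 \<le> S k \<omega>" if "k \<in> {1..N}" for k
        using that by (auto intro: less_imp_le)
      have "(\<Prod>k=1..N. ?X k (S k \<omega>)) = ennreal (\<Prod>k=1..N. S k \<omega> ^ r k * exp (- laplace_arg k z * S k \<omega>))"
        using S by (intro prod_ennreal) auto
      moreover have "0 \<le> (\<Prod>k=1..N. S k \<omega> ^ r k)"
        using S by (intro prod_nonneg) auto
      ultimately show ?case
        using elim(2)
        by (simp add: loss_kernel_eq prod.distrib prod_nonneg mult_ac flip: ennreal_mult')
    qed
  qed
  also have "\<dots> = ennreal (exp (- laplace_arg 0 z)) * (\<integral>\<^sup>+\<omega>. (\<Prod>k=1..N. ?X k (S k \<omega>)) \<partial>M)"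
    by (rule nn_integral_cmult)
       (intro borel_measurable_prod_ennreal measurable_compose[OF _ measurable_ennreal]
         borel_measurable_times borel_measurable_power borel_measurable_exp S_measurable, auto)
  also have "(\<integral>\<^sup>+\<omega>. (\<Prod>k=1..N. ?X k (S k \<omega>)) \<partial>M) = (\<Prod>k=1..N. \<integral>\<^sup>+\<omega>. ?X k (S k \<omega>) \<partial>M)"
    by (intro indep_vars_nn_integral indep_vars_compose2[OF S_indep]) auto
  also have "\<dots> = (\<Prod>k=1..N. ennreal (?m k))"
  proof (intro prod.cong refl)
    fix k assume k: "k \<in> {1..N}"
    have "(\<integral>\<^sup>+\<omega>. ?X k (S k \<omega>) \<partial>M) = (\<integral>\<^sup>+y. ennreal (gamma_density (\<alpha> k) (1 / \<alpha> k) y) * ?X k y \<partial>lborel)"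
      by (rule distributed_nn_integral[OF S_gamma[OF k], symmetric]) simp
    also have "\<dots> = ennreal ((1 / \<alpha> k) ^ r k * Gamma (\<alpha> k + real (r k)) / Gamma (\<alpha> k) *
        (1 / (1 + 1 / \<alpha> k * laplace_arg k z)) powr (\<alpha> k + real (r k)))"
      using \<alpha>_pos[OF k] laplace_arg_nonneg[OF z] k
      by (intro nn_integral_gamma_density_moment_exp) auto
    finally show "(\<integral>\<^sup>+\<omega>. ?X k (S k \<omega>) \<partial>M) = ennreal (?m k)"
      by (simp add: power_divide mult_ac)
  qed
  also have "\<dots> = ennreal (\<Prod>k=1..N. ?m k)"
  proof (intro prod_ennreal mult_nonneg_nonneg divide_nonneg_nonneg)
    fix k assume k: "k \<in> {1..N}"
    show "0 \<le> Gamma (\<alpha> k)" "0 \<le> Gamma (\<alpha> k + real (r k))" "0 \<le> \<alpha> k ^ r k"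
      using \<alpha>_pos[OF k] Gamma_real_pos[of "\<alpha> k"] Gamma_real_pos[of "\<alpha> k + real (r k)"] by auto
  qed simp
  also have "(\<Prod>k=1..N. ?m k) = moment r * (\<Prod>k=1..N. (1 / (1 + 1 / \<alpha> k * laplace_arg k z)) powr (\<alpha> k + real (r k)))"
    by (simp only: moment_def prod.distrib)
  finally show ?thesis
    by (simp add: mult_ac flip: ennreal_mult')
qed

section \<open>The generating function on the complex unit disc\<close>

definition complex_laplace_arg :: "nat \<Rightarrow> complex \<Rightarrow> complex" where
  "complex_laplace_arg k z = (\<Sum>A\<in>Obl. of_real (w A k * p A) * (1 - H A z))"

lemma H_sums:
  assumes "A \<in> Obl" "cmod z \<le> 1"
  shows "(\<lambda>n. of_real (prob {\<omega> \<in> space M. Exposure A \<omega> = n}) * z ^ n) sums H A z"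
  unfolding H_def by (rule expectation_power_sums[OF Exposure_rv[OF assms(1)] assms(2)])

lemma summable_prob_Exposure:
  assumes "A \<in> Obl"
  shows "summable (\<lambda>n. \<bar>prob {\<omega> \<in> space M. Exposure A \<omega> = n}\<bar>)"
  using sums_summable[OF prob_nat_sums[OF Exposure_rv[OF assms]]] by simp

lemma H_of_real: "H A (of_real z) = of_real (exposure_pgf A z)"
  unfolding H_def exposure_pgf_def by (simp flip: of_real_power integral_complex_of_real)

lemma H_holomorphic: "A \<in> Obl \<Longrightarrow> H A holomorphic_on ball 0 1"
  by (rule holomorphic_transform[OF powser_holomorphic_unit_disc[OF summable_prob_Exposure]])
     (auto simp: sums_iff dest!: H_sums[of A])

lemma H_continuous: "A \<in> Obl \<Longrightarrow> continuous_on (cball 0 1) (H A)"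
  by (rule continuous_on_eq[OF powser_continuous_unit_disc[OF summable_prob_Exposure]])
     (auto simp: sums_iff dest!: H_sums[of A])

lemma cmod_H_le_1:
  assumes "A \<in> Obl" "cmod z \<le> 1"
  shows "cmod (H A z) \<le> 1"
proof -
  have "cmod (H A z) \<le> (LINT \<omega>|M. cmod (z ^ Exposure A \<omega>))"
    unfolding H_def by (rule integral_norm_bound)
  also have "\<dots> \<le> (LINT \<omega>|M. 1)"
    using Exposure_rv[OF assms(1)] assms(2)
    by (intro integral_mono integrable_const_bound[where B=1]) (auto simp: norm_power power_le_one)
  finally show ?thesis
    by (simp add: prob_space)
qed

lemma complex_laplace_arg_of_real: "complex_laplace_arg k (of_real z) = of_real (laplace_arg k z)"
  by (simp add: complex_laplace_arg_def laplace_arg_def H_of_real)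

text \<open>H has modulus at most 1 on the closed disc. This sign is what keeps the bases of the
  complex powers in the right half-plane.\<close>

lemma Re_complex_laplace_arg:
  assumes "cmod z \<le> 1" "k \<in> {0..N}"
  shows "0 \<le> Re (complex_laplace_arg k z)"
proof -
  have "Re (complex_laplace_arg k z) = (\<Sum>A\<in>Obl. w A k * p A * (1 - Re (H A z)))"
    by (simp add: complex_laplace_arg_def)
  also have "\<dots> \<ge> 0"
  proof (intro sum_nonneg mult_nonneg_nonneg)
    fix A assume A: "A \<in> Obl"
    show "0 \<le> w A k" "0 \<le> p A"
      using w_bounds[OF A assms(2)] p_pos[OF A] by auto
    show "0 \<le> 1 - Re (H A z)"
      using cmod_H_le_1[OF A assms(1)] complex_Re_le_cmod[of "H A z"] by simp
  qed
  finally show ?thesis .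
qed

text \<open>Removes the division by \<open>\<mu> k\<close>. If \<open>\<mu> k = 0\<close>, its
  non-negative summands all vanish, hence so does \<open>complex_laplace_arg k z\<close>, and the
  convention for division by zero gives the right value.\<close>

lemma \<mu>_times_\<Q>:
  assumes "k \<in> {0..N}"
  shows "of_real (\<mu> k) * \<Q> k z = of_real (\<mu> k) - complex_laplace_arg k z"
proof (cases "\<mu> k = 0")
  case True
  have "0 \<le> w A k * p A" if "A \<in> Obl" for A
    using w_bounds[OF that assms] p_pos[OF that] by simp
  hence "w A k * p A = 0" if "A \<in> Obl" for A
    using True that finite_Obl sum_nonneg_eq_0_iff[of Obl "\<lambda>A. w A k * p A"] by (auto simp: \<mu>_def)
  hence "of_real (w A k * p A) * (1 - H A z) = 0" if "A \<in> Obl" for A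
    using that by (metis mult_zero_left of_real_0)
  hence "complex_laplace_arg k z = 0"
    unfolding complex_laplace_arg_def by (intro sum.neutral ballI)
  thus ?thesis
    using True by simp
next
  case False
  thus ?thesis
    by (simp add: \<Q>_def complex_laplace_arg_def right_diff_distrib sum_subtractf) (simp add: \<mu>_def)
qed

text \<open>Clearing the denominator \<mu> + \<alpha> turns (1 - \<delta>) / (1 - \<delta> Q) into
  \<alpha> / (\<alpha> + \<mu> - \<mu> Q), where \<mu> - \<mu> Q is
  \<open>complex_laplace_arg\<close>.\<close>

lemma loss_gf_eq:
  assumes z: "cmod z \<le> 1"
  shows "loss_gf \<alpha>' z = exp (- complex_laplace_arg 0 z) *
    (\<Prod>k=1..N. (1 / (1 + of_real (1 / \<alpha> k) * complex_laplace_arg k z)) powr of_real (\<alpha>' k))"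
proof -
  have "of_real (\<mu> 0) * (\<Q> 0 z - 1) = - complex_laplace_arg 0 z"
    using \<mu>_times_\<Q>[of 0 z] by (simp add: algebra_simps)
  moreover have "(1 - of_real (\<delta> k)) / (1 - of_real (\<delta> k) * \<Q> k z)
      = 1 / (1 + of_real (1 / \<alpha> k) * complex_laplace_arg k z)" if k: "k \<in> {1..N}" for k
  proof -
    have k0: "k \<in> {0..N}"
      using k by auto
    have "0 \<le> \<mu> k"
      unfolding \<mu>_def using w_bounds k0 p_pos by (intro sum_nonneg mult_nonneg_nonneg) (auto intro: less_imp_le)
    hence pos: "0 < \<mu> k + \<alpha> k"
      using \<alpha>_pos[OF k] by simp
    hence nz: "complex_of_real (\<mu> k) + of_real (\<alpha> k) \<noteq> 0"
      by (metis of_real_add of_real_eq_0_iff less_irrefl)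
    have \<alpha>: "complex_of_real (\<alpha> k) \<noteq> 0"
      using \<alpha>_pos[OF k] by simp
    have "0 < Re (of_real (\<alpha> k) + complex_laplace_arg k z)"
      using \<alpha>_pos[OF k] Re_complex_laplace_arg[OF z k0] by simp
    hence nz': "of_real (\<alpha> k) + complex_laplace_arg k z \<noteq> 0"
      by (metis less_irrefl zero_complex.sel(1))
    have "1 - of_real (\<delta> k) = complex_of_real (\<alpha> k) / (of_real (\<mu> k) + of_real (\<alpha> k))"
      using nz by (simp add: \<delta>_def field_simps)
    moreover have "1 - of_real (\<delta> k) * \<Q> k z
        = (of_real (\<mu> k) + of_real (\<alpha> k) - of_real (\<mu> k) * \<Q> k z) / (of_real (\<mu> k) + of_real (\<alpha> k))"
      using nz by (simp add: \<delta>_def field_simps)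
    ultimately have "(1 - of_real (\<delta> k)) / (1 - of_real (\<delta> k) * \<Q> k z)
        = of_real (\<alpha> k) / (of_real (\<alpha> k) + complex_laplace_arg k z)"
      using nz by (simp add: \<mu>_times_\<Q>[OF k0])
    also have "\<dots> = 1 / (1 + of_real (1 / \<alpha> k) * complex_laplace_arg k z)"
      using \<alpha> nz' by (simp add: field_simps)
    finally show ?thesis .
  qed
  ultimately show ?thesis
    by (simp add: loss_gf_def)
qed

text \<open>Taking reciprocals preserves the open right half-plane.\<close>

lemma Re_loss_gf_base:
  assumes "cmod z \<le> 1" "k \<in> {1..N}"
  shows "0 < Re (1 / (1 + of_real (1 / \<alpha> k) * complex_laplace_arg k z))"
proof -
  have "0 < Re (1 + of_real (1 / \<alpha> k) * complex_laplace_arg k z)"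
    using Re_complex_laplace_arg[of z k] \<alpha>_pos[OF assms(2)] assms by (simp add: add_pos_nonneg)
  moreover have "0 < Re (1 / u)" if "0 < Re u" for u
    using that by (simp add: Re_divide sum_power2_gt_zero_iff divide_pos_pos)
  ultimately show ?thesis
    by blast
qed

lemma loss_gf_base_denom_nonzero:
  assumes "cmod z \<le> 1" "k \<in> {1..N}"
  shows "1 + of_real (1 / \<alpha> k) * complex_laplace_arg k z \<noteq> 0"
  using Re_loss_gf_base[OF assms] by force

lemma loss_gf_holomorphic: "loss_gf \<alpha>' holomorphic_on ball 0 1"
proof (rule holomorphic_transform)
  have "complex_laplace_arg k holomorphic_on ball 0 1" for k
    unfolding complex_laplace_arg_def by (intro holomorphic_intros H_holomorphic)
  moreover have "1 / (1 + of_real (1 / \<alpha> k) * complex_laplace_arg k z) \<notin> \<real>\<^sub>\<le>\<^sub>0"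
    if "z \<in> ball 0 1" "k \<in> {1..N}" for z k
    using Re_loss_gf_base[of z k] that by (auto simp: complex_nonpos_Reals_iff)
  ultimately show "(\<lambda>z. exp (- complex_laplace_arg 0 z) *
    (\<Prod>k=1..N. (1 / (1 + of_real (1 / \<alpha> k) * complex_laplace_arg k z)) powr of_real (\<alpha>' k))) holomorphic_on ball 0 1"
    using loss_gf_base_denom_nonzero by (intro holomorphic_intros) auto
qed (auto simp: loss_gf_eq)

lemma loss_gf_continuous: "continuous_on (cball 0 1) (loss_gf \<alpha>')"
proof (rule continuous_on_eq)
  have c: "continuous_on (cball 0 1) (complex_laplace_arg k)" for k
    unfolding complex_laplace_arg_def by (intro continuous_intros H_continuous)
  show "continuous_on (cball 0 1) (\<lambda>z. exp (- complex_laplace_arg 0 z) *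
    (\<Prod>k=1..N. (1 / (1 + of_real (1 / \<alpha> k) * complex_laplace_arg k z)) powr of_real (\<alpha>' k)))"
  proof (intro continuous_on_mult continuous_on_exp continuous_on_minus c continuous_on_prod continuous_on_powr_complex)
    fix k assume k: "k \<in> {1..N}"
    \<comment> \<open>\<open>continuous_on_powr_complex\<close> asks the base to avoid the negative
      real axis and the exponent to have positive real part wherever the base is 0. The second
      demand is vacuous, as the base never vanishes.\<close>
    show "cball 0 1 \<subseteq> {z. 0 \<le> Re (1 / (1 + of_real (1 / \<alpha> k) * complex_laplace_arg k z)) \<or>
        Im (1 / (1 + of_real (1 / \<alpha> k) * complex_laplace_arg k z)) \<noteq> 0}"
      using Re_loss_gf_base[OF _ k] by (auto intro: less_imp_le)
    show "0 < Re (of_real (\<alpha>' k))"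
      if "z \<in> cball 0 1" "1 / (1 + of_real (1 / \<alpha> k) * complex_laplace_arg k z) = 0" for z
      using Re_loss_gf_base[OF _ k, of z] that by simp
    show "continuous_on (cball 0 1) (\<lambda>z. 1 / (1 + of_real (1 / \<alpha> k) * complex_laplace_arg k z))"
      using loss_gf_base_denom_nonzero[OF _ k] by (intro continuous_intros c) auto
  qed auto
qed (auto simp: loss_gf_eq)

lemma loss_gf_of_real:
  assumes z: "0 \<le> z" "z \<le> 1"
  shows "loss_gf \<alpha>' (of_real z) = of_real (exp (- laplace_arg 0 z) *
        (\<Prod>k=1..N. (1 / (1 + 1 / \<alpha> k * laplace_arg k z)) powr \<alpha>' k))"
proof -
  have "(1 / (1 + of_real (1 / \<alpha> k) * of_real (laplace_arg k z))) powr of_real (\<alpha>' k)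
      = complex_of_real ((1 / (1 + 1 / \<alpha> k * laplace_arg k z)) powr \<alpha>' k)" if k: "k \<in> {1..N}" for k
  proof -
    have "0 \<le> 1 / (1 + 1 / \<alpha> k * laplace_arg k z)"
      using laplace_arg_nonneg[OF z, of k] \<alpha>_pos[OF k] k by simp
    from powr_of_real[OF this, of "\<alpha>' k"] show ?thesis
      by simp
  qed
  thus ?thesis
    using z by (simp add: loss_gf_eq complex_laplace_arg_of_real exp_of_real flip: of_real_minus)
qed

lemma loss_gf_1: "loss_gf \<alpha>' 1 = 1"
proof -
  have "exposure_pgf A 1 = 1" for A
    by (simp add: exposure_pgf_def prob_space)
  hence "laplace_arg k 1 = 0" for k
    by (simp add: laplace_arg_def)
  thus ?thesis
    using loss_gf_of_real[of 1 \<alpha>'] by simp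
qed

text \<open>Reduces the definite description to real points. Existence on the closed disc follows by
  continuation, uniqueness by comparing coefficients on [0,1).\<close>

lemma loss_law_eqI:
  assumes "\<And>z. 0 \<le> z \<Longrightarrow> z \<le> 1 \<Longrightarrow> loss_gf \<alpha>' (of_real z) = of_real (\<Sum>m. pmf q m * z ^ m)"
  shows "loss_law \<alpha>' = q"
proof -
  have summable: "summable (\<lambda>m. \<bar>pmf q' m\<bar>)" for q' :: "nat pmf"
  proof -
    have "(\<Sum>m. ennreal (pmf q' m)) = 1"
      using nn_integral_pmf[where p = q' and A = UNIV] by (simp add: nn_integral_count_space_nat)
    thus ?thesis
      by (intro summable_suminf_not_top) auto
  qed
  show ?thesis
    unfolding loss_law_def
  proof (rule the_equality)
    show "\<forall>z. cmod z \<le> 1 \<longrightarrow> (\<lambda>m. of_real (pmf q m) * z ^ m) sums loss_gf \<alpha>' z"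
      using sums_unit_disc_if_sums_unit_interval[OF summable loss_gf_holomorphic loss_gf_continuous] assms
      by blast
  next
    fix q' assume q': "\<forall>z. cmod z \<le> 1 \<longrightarrow> (\<lambda>m. of_real (pmf q' m) * z ^ m) sums loss_gf \<alpha>' z"
    have "pmf q' = pmf q"
    proof (rule powser_eq_imp_coeff_eq[OF summable summable])
      fix z :: real assume z: "0 \<le> z" "z < 1"
      hence "(\<lambda>m. complex_of_real (pmf q' m * z ^ m)) sums of_real (\<Sum>m. pmf q m * z ^ m)"
        using q'[rule_format, of "of_real z"] assms[of z] by simp
      thus "(\<Sum>m. pmf q' m * z ^ m) = (\<Sum>m. pmf q m * z ^ m)"
        by (simp only: sums_of_real_iff) (simp add: sums_iff)
    qed
    thus "q' = q"
      by (intro pmf_eqI) simp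
  qed
qed

text \<open>The integrals on the left, divided by \<open>moment r\<close>, are the point masses of
  the loss under the normalised weight. Their generating function on [0,1] is \<open>loss_gf\<close>
  for the shifted parameters, which identifies them with \<open>loss_law\<close>.\<close>

lemma nn_integral_moment_loss_eq:
  assumes ne: "Obl \<noteq> {}"
  shows "(\<integral>\<^sup>+\<omega>. ennreal (\<Prod>k=1..N. S k \<omega> ^ r k) * indicator {\<omega>. loss \<omega> = m} \<omega> \<partial>M)
    = ennreal (moment r * pmf (loss_law (\<lambda>k. \<alpha> k + real (r k))) m)"
proof -
  let ?\<alpha>' = "\<lambda>k. \<alpha> k + real (r k)"
  let ?W = "\<lambda>\<omega>. ennreal (\<Prod>k=1..N. S k \<omega> ^ r k)"
  define I where "I m = (\<integral>\<^sup>+\<omega>. ?W \<omega> * indicator {\<omega>. loss \<omega> = m} \<omega> \<partial>M)" for m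
  define a where "a m = enn2real (I m) / moment r" for m
  have [measurable]: "?W \<in> borel_measurable M"
    by (intro measurable_compose[OF _ measurable_ennreal] borel_measurable_prod borel_measurable_power S_measurable) auto
  have gf: "(\<integral>\<^sup>+m. I m * ennreal (z ^ m) \<partial>count_space UNIV) = ennreal (moment r * Re (loss_gf ?\<alpha>' (of_real z)))"
    if z: "0 \<le> z" "z \<le> 1" for z
  proof -
    have "(\<integral>\<^sup>+\<omega>. ?W \<omega> * ennreal (z ^ loss \<omega>) \<partial>M) = (\<integral>\<^sup>+m. I m * ennreal (z ^ m) \<partial>count_space UNIV)"
      unfolding I_def by (rule nn_integral_pow_loss_fiber) simp
    thus ?thesis
      using nn_integral_moment_pow_loss[OF z ne, of r] unfolding loss_gf_of_real[OF z] Re_complex_of_real by simp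
  qed
  have total: "(\<integral>\<^sup>+m. I m \<partial>count_space UNIV) = ennreal (moment r)"
    using gf[of 1] loss_gf_1 by simp
  have "I m \<noteq> \<infinity>" for m
  proof
    assume "I m = \<infinity>"
    moreover have "I m \<le> (\<integral>\<^sup>+m. I m \<partial>count_space UNIV)"
      by (rule nn_integral_ge_point) simp
    ultimately show False
      using total by (simp add: top_unique)
  qed
  hence I: "I m = ennreal (moment r * a m)" for m
    using moment_pos[of r] by (simp add: a_def top.not_eq_extremum)
  have a_nonneg: "0 \<le> a m" for m
    using moment_pos[of r] by (simp add: a_def)
  have I': "I m * ennreal (z ^ m) = ennreal (moment r) * ennreal (a m * z ^ m)" if "0 \<le> z" for m z
    using a_nonneg[of m] moment_pos[of r] that by (simp add: I mult.assoc flip: ennreal_mult')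
  have gf_a: "(\<Sum>m. ennreal (a m * z ^ m)) = ennreal (Re (loss_gf ?\<alpha>' (of_real z)))"
    if z: "0 \<le> z" "z \<le> 1" for z
  proof -
    have "ennreal (moment r) * (\<Sum>m. ennreal (a m * z ^ m)) = ennreal (moment r) * ennreal (Re (loss_gf ?\<alpha>' (of_real z)))"
      using gf[OF z] I'[OF z(1)] moment_pos[of r]
      by (simp add: nn_integral_count_space_nat ennreal_mult')
    thus ?thesis
      using moment_pos[of r] by (subst (asm) ennreal_mult_cancel_left) auto
  qed
  have a_total: "(\<integral>\<^sup>+m. ennreal (a m) \<partial>count_space UNIV) = 1"
    using gf_a[of 1] loss_gf_1 by (simp add: nn_integral_count_space_nat)
  \<comment> \<open>Total mass 1, obtained from \<open>loss_gf\<close> at 1, makes the normalised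
    coefficients a genuine \<open>pmf\<close>.\<close>
  define q where "q = embed_pmf a"
  have q: "pmf q m = a m" for m
    unfolding q_def by (rule pmf_embed_pmf[OF a_nonneg a_total])
  have "loss_law ?\<alpha>' = q"
  proof (rule loss_law_eqI)
    fix z :: real assume z: "0 \<le> z" "z \<le> 1"
    have summable: "summable (\<lambda>m. a m * z ^ m)"
      using a_nonneg z gf_a[OF z] by (intro summable_suminf_not_top) auto
    have R: "0 \<le> Re (loss_gf ?\<alpha>' (of_real z))"
      unfolding loss_gf_of_real[OF z] Re_complex_of_real by (intro mult_nonneg_nonneg prod_nonneg) auto
    have "ennreal (\<Sum>m. a m * z ^ m) = ennreal (Re (loss_gf ?\<alpha>' (of_real z)))"
      using gf_a[OF z] a_nonneg z summable by (subst (asm) suminf_ennreal2) auto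
    hence "(\<Sum>m. a m * z ^ m) = Re (loss_gf ?\<alpha>' (of_real z))"
      using R a_nonneg z by (subst (asm) ennreal_inj) (auto intro!: suminf_nonneg summable)
    thus "loss_gf ?\<alpha>' (of_real z) = of_real (\<Sum>m. pmf q m * z ^ m)"
      unfolding q by (simp add: loss_gf_of_real[OF z])
  qed
  thus ?thesis
    using I[of m] q by (simp add: I_def)
qed

section \<open>Mixed moments of two default counts\<close>

text \<open>The exponents of the monomial \<open>S i * S j\<close> in \<open>S 1, ..., S N\<close>; as \<open>S 0 = 1\<close>, an index \<open>0\<close> leaves no trace.\<close>

definition pair_exponents :: "nat \<Rightarrow> nat \<Rightarrow> nat \<Rightarrow> nat" where
  "pair_exponents i j k = of_bool (k = i) + of_bool (k = j)"

lemma prod_S_pair_exponents: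
  assumes "\<omega> \<in> space M" "i \<in> {0..N}" "j \<in> {0..N}"
  shows "(\<Prod>k=1..N. S k \<omega> ^ pair_exponents i j k) = S i \<omega> * S j \<omega>"
proof -
  have "(\<Prod>k=1..N. S k \<omega> ^ of_bool (k = l)) = S l \<omega>" if "l \<in> {0..N}" for l
  proof -
    have "(\<Prod>k=1..N. S k \<omega> ^ of_bool (k = l)) = (\<Prod>k=1..N. if k = l then S k \<omega> else 1)"
      by (intro prod.cong) auto
    also have "\<dots> = S l \<omega>"
      using that S_0[OF assms(1)] by (cases "l = 0") (auto simp: prod.delta)
    finally show ?thesis .
  qed
  thus ?thesis
    using assms by (simp add: pair_exponents_def power_add prod.distrib)
qed

text \<open>Two applications of the functional equation of Gamma give E[S_i^2] = (\<alpha>_i + 1) /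
  \<alpha>_i, one gives E[S_i] = 1.\<close>

lemma moment_pair_exponents:
  "moment (pair_exponents i j) = (if i = j \<and> i \<in> {1..N} then (\<alpha> i + 1) / \<alpha> i else 1)"
proof -
  \<comment> \<open>The factor at k = j is 1 when i and j differ, so the right-hand side needs to
    single out k = i only.\<close>
  have "Gamma (\<alpha> k + real (pair_exponents i j k)) / (Gamma (\<alpha> k) * \<alpha> k ^ pair_exponents i j k)
      = (if k = i then (if i = j then (\<alpha> k + 1) / \<alpha> k else 1) else 1)" if k: "k \<in> {1..N}" for k
  proof -
    have a: "0 < \<alpha> k"
      using \<alpha>_pos[OF k] .
    have G: "Gamma (\<alpha> k) \<noteq> 0"
      using Gamma_real_pos[OF a] by simp
    have G1: "Gamma (\<alpha> k + 1) = \<alpha> k * Gamma (\<alpha> k)"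
      using a by (intro Gamma_plus1) (auto dest: nonpos_Ints_nonpos)
    have G2: "Gamma (\<alpha> k + 2) = (\<alpha> k + 1) * (\<alpha> k * Gamma (\<alpha> k))"
    proof -
      have "\<alpha> k + 1 \<notin> \<int>\<^sub>\<le>\<^sub>0"
        using a nonpos_Ints_nonpos[of "\<alpha> k + 1"] by linarith
      from Gamma_plus1[OF this] show ?thesis
        by (simp add: G1 add.assoc)
    qed
    show ?thesis
      using a G G1 G2 by (auto simp: pair_exponents_def power2_eq_square)
  qed
  hence "moment (pair_exponents i j) = (\<Prod>k=1..N. if k = i then (if i = j then (\<alpha> k + 1) / \<alpha> k else 1) else 1)"
    unfolding moment_def by (intro prod.cong) auto
  thus ?thesis
    by (auto simp: prod.delta)
qed

lemma moment_0: "moment (\<lambda>_. 0) = 1"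
  unfolding moment_def using \<alpha>_pos by (intro prod.neutral) (auto simp: Gamma_real_pos less_imp_neq[symmetric])

text \<open>The case r = 0: for the actual parameters the described law is the distribution of the
  loss, so the conditioning event has the expected probability.\<close>

lemma emeasure_loss_eq:
  assumes "Obl \<noteq> {}"
  shows "emeasure M {\<omega> \<in> space M. loss \<omega> = m} = ennreal (pmf (loss_law \<alpha>) m)"
proof -
  have "emeasure M {\<omega> \<in> space M. loss \<omega> = m} = (\<integral>\<^sup>+\<omega>. indicator {\<omega> \<in> space M. loss \<omega> = m} \<omega> \<partial>M)"
    by (rule nn_integral_indicator[symmetric]) measurable
  also have "\<dots> = (\<integral>\<^sup>+\<omega>. ennreal (\<Prod>k=1..N. S k \<omega> ^ 0) * indicator {\<omega>. loss \<omega> = m} \<omega> \<partial>M)"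
    by (intro nn_integral_cong) (auto split: split_indicator)
  finally show ?thesis
    using nn_integral_moment_loss_eq[OF assms, of "\<lambda>_. 0" m] by (simp add: moment_0)
qed

text \<open>The coefficient of \<open>S i * S j\<close> in the product of the two intensities, times
  the expectation of that monomial.\<close>

definition pair_coeff :: "'o \<Rightarrow> 'o \<Rightarrow> nat \<Rightarrow> nat \<Rightarrow> real" where
  "pair_coeff A1 A2 i j = p A1 * p A2 * (w A1 i * w A2 j * moment (pair_exponents i j))"

definition pair_law :: "nat \<Rightarrow> nat \<Rightarrow> nat pmf" where
  "pair_law i j = loss_law (\<lambda>k. \<alpha> k + real (pair_exponents i j k))"

lemma pair_coeff_nonneg:
  assumes "A1 \<in> Obl" "A2 \<in> Obl" "i \<in> {0..N}" "j \<in> {0..N}"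
  shows "0 \<le> pair_coeff A1 A2 i j"
  unfolding pair_coeff_def
  using w_bounds assms p_pos moment_pos by (intro mult_nonneg_nonneg) (auto intro: less_imp_le)

lemma nn_integral_intensities_loss_eq:
  assumes A1: "A1 \<in> Obl" and A2: "A2 \<in> Obl"
  shows "(\<integral>\<^sup>+\<omega>. ennreal (intensity A1 \<omega> * intensity A2 \<omega>) * indicator {\<omega>. loss \<omega> = m} \<omega> \<partial>M)
    = ennreal (\<Sum>i=0..N. \<Sum>j=0..N. pair_coeff A1 A2 i j * pmf (pair_law i j) m)"
proof -
  let ?c = "\<lambda>i j. p A1 * p A2 * (w A1 i * w A2 j)"
  let ?S = "\<lambda>i j \<omega>. ennreal (\<Prod>k=1..N. S k \<omega> ^ pair_exponents i j k)"
  have c: "0 \<le> ?c i j" if "i \<in> {0..N}" "j \<in> {0..N}" for i j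
    using w_bounds that A1 A2 p_pos by (intro mult_nonneg_nonneg) (auto intro: less_imp_le)
  have [measurable]: "(\<lambda>\<omega>. ?S i j \<omega> * indicator {\<omega>. loss \<omega> = m} \<omega>) \<in> borel_measurable M" for i j
    by (intro borel_measurable_times_ennreal loss_eq_measurable measurable_compose[OF _ measurable_ennreal]
        borel_measurable_prod borel_measurable_power S_measurable) auto
  have "(\<integral>\<^sup>+\<omega>. ennreal (intensity A1 \<omega> * intensity A2 \<omega>) * indicator {\<omega>. loss \<omega> = m} \<omega> \<partial>M)
    = (\<integral>\<^sup>+\<omega>. (\<Sum>i=0..N. \<Sum>j=0..N. ennreal (?c i j) * (?S i j \<omega> * indicator {\<omega>. loss \<omega> = m} \<omega>)) \<partial>M)"
  proof (rule nn_integral_cong_AE)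
    show "AE \<omega> in M. ennreal (intensity A1 \<omega> * intensity A2 \<omega>) * indicator {\<omega>. loss \<omega> = m} \<omega>
      = (\<Sum>i=0..N. \<Sum>j=0..N. ennreal (?c i j) * (?S i j \<omega> * indicator {\<omega>. loss \<omega> = m} \<omega>))"
      using S_nonneg AE_space
    proof eventually_elim
      case (elim \<omega>)
      have "intensity A1 \<omega> * intensity A2 \<omega>
          = p A1 * p A2 * ((\<Sum>i=0..N. w A1 i * S i \<omega>) * (\<Sum>j=0..N. w A2 j * S j \<omega>))"
        by (simp add: intensity_def)
      also have "\<dots> = (\<Sum>i=0..N. \<Sum>j=0..N. ?c i j * (S i \<omega> * S j \<omega>))"
        unfolding sum_product by (simp add: sum_distrib_left mult_ac)
      also have "ennreal \<dots> = (\<Sum>i=0..N. \<Sum>j=0..N. ennreal (?c i j * (S i \<omega> * S j \<omega>)))"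
        using c elim(1)
        by (intro ennreal_double_sum mult_nonneg_nonneg[OF c mult_nonneg_nonneg]) auto
      also have "\<dots> = (\<Sum>i=0..N. \<Sum>j=0..N. ennreal (?c i j) * ?S i j \<omega>)"
        using c prod_S_pair_exponents[OF elim(2)] by (intro sum.cong refl) (simp add: ennreal_mult')
      finally show ?case
        by (simp add: sum_distrib_right mult.assoc)
    qed
  qed
  also have "\<dots> = (\<Sum>i=0..N. \<Sum>j=0..N. ennreal (?c i j) * (\<integral>\<^sup>+\<omega>. ?S i j \<omega> * indicator {\<omega>. loss \<omega> = m} \<omega> \<partial>M))"
    by (simp add: nn_integral_sum nn_integral_cmult)
  also have "\<dots> = (\<Sum>i=0..N. \<Sum>j=0..N. ennreal (pair_coeff A1 A2 i j * pmf (pair_law i j) m))"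
  proof (intro sum.cong refl)
    fix i j assume "i \<in> {0..N}" "j \<in> {0..N}"
    note c = c[OF this]
    have "(\<integral>\<^sup>+\<omega>. ?S i j \<omega> * indicator {\<omega>. loss \<omega> = m} \<omega> \<partial>M) = ennreal (moment (pair_exponents i j) * pmf (pair_law i j) m)"
      unfolding pair_law_def using A1 by (intro nn_integral_moment_loss_eq) auto
    thus "ennreal (?c i j) * (\<integral>\<^sup>+\<omega>. ?S i j \<omega> * indicator {\<omega>. loss \<omega> = m} \<omega> \<partial>M)
        = ennreal (pair_coeff A1 A2 i j * pmf (pair_law i j) m)"
      using c by (simp add: pair_coeff_def mult.assoc flip: ennreal_mult')
  qed
  also have "\<dots> = ennreal (\<Sum>i=0..N. \<Sum>j=0..N. pair_coeff A1 A2 i j * pmf (pair_law i j) m)"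
    using pair_coeff_nonneg[OF A1 A2] by (intro ennreal_double_sum[symmetric] mult_nonneg_nonneg) auto
  finally show ?thesis .
qed

text \<open>Multiplying a generating function by those of the two exposures convolves its
  coefficients with both exposure laws. Comparing coefficients gives the nested sums.\<close>

lemma nn_integral_D_D_loss_eq:
  assumes A1: "A1 \<in> Obl" and A2: "A2 \<in> Obl" and distinct: "A1 \<noteq> A2"
  defines "P \<equiv> \<lambda>A n. prob {\<omega> \<in> space M. Exposure A \<omega> = n}"
    and "V \<equiv> \<lambda>m. \<Sum>i=0..N. \<Sum>j=0..N. pair_coeff A1 A2 i j * pmf (pair_law i j) m"
  shows "(\<integral>\<^sup>+\<omega>. ennreal (real (D A1 \<omega>) * real (D A2 \<omega>)) * indicator {\<omega>. loss \<omega> = m} \<omega> \<partial>M)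
    = ennreal (\<Sum>a\<le>m. P A1 a * (\<Sum>b\<le>m - a. P A2 b * V (m - a - b)))"
proof -
  let ?u = "\<lambda>m. \<integral>\<^sup>+\<omega>. ennreal (real (D A1 \<omega>) * real (D A2 \<omega>)) * indicator {\<omega>. loss \<omega> = m} \<omega> \<partial>M"
  let ?v = "\<lambda>m. \<Sum>a\<le>m. ennreal (P A1 a) * (\<Sum>b\<le>m - a. ennreal (P A2 b) * ennreal (V (m - a - b)))"
  have D_meas: "(\<lambda>\<omega>. ennreal (real (D A1 \<omega>) * real (D A2 \<omega>))) \<in> borel_measurable M"
    using A1 A2
    by (intro measurable_compose[OF _ measurable_ennreal] borel_measurable_times
        measurable_compose[OF D_measurable]) auto
  have I_meas: "(\<lambda>\<omega>. ennreal (intensity A1 \<omega> * intensity A2 \<omega>)) \<in> borel_measurable M"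
    unfolding intensity_def
    by (intro measurable_compose[OF _ measurable_ennreal] borel_measurable_times borel_measurable_sum S_measurable) auto
  have h: "ennreal (exposure_pgf A z) = (\<integral>\<^sup>+n. ennreal (P A n) * ennreal (z ^ n) \<partial>count_space UNIV)"
    if A: "A \<in> Obl" and z: "0 \<le> z" "z \<le> 1" for A z
  proof -
    note [measurable] = Exposure_rv[OF A]
    have "ennreal (exposure_pgf A z) = (\<integral>\<^sup>+\<omega>. ennreal (z ^ Exposure A \<omega>) \<partial>M)"
      using nn_integral_pow_Exposure[OF A z] by simp
    also have "\<dots> = (\<integral>\<^sup>+n. (\<integral>\<^sup>+\<omega>. ennreal (z ^ Exposure A \<omega>) * indicator {\<omega>. Exposure A \<omega> = n} \<omega> \<partial>M) \<partial>count_space UNIV)"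
      by (intro nn_integral_eq_nn_integral_fiber) auto
    also have "\<dots> = (\<integral>\<^sup>+n. ennreal (P A n) * ennreal (z ^ n) \<partial>count_space UNIV)"
    proof (rule nn_integral_cong)
      fix n
      have "(\<integral>\<^sup>+\<omega>. ennreal (z ^ Exposure A \<omega>) * indicator {\<omega>. Exposure A \<omega> = n} \<omega> \<partial>M)
        = (\<integral>\<^sup>+\<omega>. ennreal (z ^ n) * indicator {\<omega> \<in> space M. Exposure A \<omega> = n} \<omega> \<partial>M)"
        by (intro nn_integral_cong) (auto split: split_indicator)
      also have "\<dots> = ennreal (z ^ n) * emeasure M {\<omega> \<in> space M. Exposure A \<omega> = n}"
        by (rule nn_integral_cmult_indicator) measurable
      finally show "(\<integral>\<^sup>+\<omega>. ennreal (z ^ Exposure A \<omega>) * indicator {\<omega>. Exposure A \<omega> = n} \<omega> \<partial>M)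
        = ennreal (P A n) * ennreal (z ^ n)"
        by (simp add: P_def emeasure_eq_measure mult.commute)
    qed
    finally show ?thesis .
  qed
  have gf: "(\<integral>\<^sup>+m. ?v m * ennreal (z ^ m) \<partial>count_space UNIV) = (\<integral>\<^sup>+m. ?u m * ennreal (z ^ m) \<partial>count_space UNIV)"
    if z: "0 \<le> z" "z \<le> 1" for z
  proof -
    have "(\<integral>\<^sup>+m. ?u m * ennreal (z ^ m) \<partial>count_space UNIV)
      = (\<integral>\<^sup>+\<omega>. ennreal (real (D A1 \<omega>) * real (D A2 \<omega>)) * ennreal (z ^ loss \<omega>) \<partial>M)"
      by (rule nn_integral_pow_loss_fiber[OF D_meas, symmetric])
    also have "\<dots> = ennreal (exposure_pgf A1 z) * (ennreal (exposure_pgf A2 z) *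
      (\<integral>\<^sup>+\<omega>. ennreal (intensity A1 \<omega> * intensity A2 \<omega>) * ennreal (z ^ loss \<omega>) \<partial>M))"
      using nn_integral_D_D_pow_loss[OF A1 A2 distinct z] exposure_pgf_nonneg[OF z(1)]
      by (simp add: ennreal_mult mult.assoc)
    also have "\<dots> = ennreal (exposure_pgf A1 z) * (ennreal (exposure_pgf A2 z) *
      (\<integral>\<^sup>+m. ennreal (V m) * ennreal (z ^ m) \<partial>count_space UNIV))"
      unfolding nn_integral_pow_loss_fiber[OF I_meas] nn_integral_intensities_loss_eq[OF A1 A2] V_def ..
    also have "\<dots> = (\<integral>\<^sup>+m. ?v m * ennreal (z ^ m) \<partial>count_space UNIV)"
      unfolding h[OF A1 z] h[OF A2 z] nn_integral_powser_mult[OF z(1)] ..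
    finally show ?thesis
      by simp
  qed
  have V_nonneg: "0 \<le> V m" for m
    unfolding V_def using pair_coeff_nonneg[OF A1 A2] by (intro sum_nonneg mult_nonneg_nonneg) auto
  have "?v = ?u"
  \<comment> \<open>Finiteness is checked on the convolution side, where the total mass is the
    finite sum of the \<open>pair_coeff\<close> values; integrability of the product of default
    counts is not presupposed.\<close>
  proof (rule nn_integral_powser_eq_imp_coeff_eq[OF gf])
    have pgf_1: "exposure_pgf A 1 = 1" for A
      by (simp add: exposure_pgf_def prob_space)
    have "(\<integral>\<^sup>+m. ?v m \<partial>count_space UNIV) = (\<integral>\<^sup>+m. ennreal (V m) \<partial>count_space UNIV)"
      using nn_integral_powser_mult[of 1 "\<lambda>n. ennreal (P A2 n)" "\<lambda>n. ennreal (V n)"]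
        nn_integral_powser_mult[of 1 "\<lambda>n. ennreal (P A1 n)"
          "\<lambda>m. \<Sum>b\<le>m. ennreal (P A2 b) * ennreal (V (m - b))"]
        h[OF A1, of 1] h[OF A2, of 1] by (simp add: pgf_1)
    also have "\<dots> = (\<integral>\<^sup>+m. (\<Sum>i=0..N. \<Sum>j=0..N. ennreal (pair_coeff A1 A2 i j) * ennreal (pmf (pair_law i j) m)) \<partial>count_space UNIV)"
    proof (rule nn_integral_cong)
      fix m
      have "ennreal (V m) = (\<Sum>i=0..N. \<Sum>j=0..N. ennreal (pair_coeff A1 A2 i j * pmf (pair_law i j) m))"
        unfolding V_def using pair_coeff_nonneg[OF A1 A2] by (intro ennreal_double_sum mult_nonneg_nonneg) auto
      thus "ennreal (V m) = (\<Sum>i=0..N. \<Sum>j=0..N. ennreal (pair_coeff A1 A2 i j) * ennreal (pmf (pair_law i j) m))"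
        using pair_coeff_nonneg[OF A1 A2] by (simp add: ennreal_mult')
    qed
    also have "\<dots> = (\<Sum>i=0..N. \<Sum>j=0..N. ennreal (pair_coeff A1 A2 i j))"
      by (simp add: nn_integral_sum nn_integral_cmult nn_integral_pmf)
    also have "\<dots> \<noteq> \<infinity>"
      by simp
    finally show "(\<integral>\<^sup>+m. ?v m \<partial>count_space UNIV) \<noteq> \<infinity>" .
  qed
  hence "?u m = ?v m"
    by metis
  also have "\<dots> = (\<Sum>a\<le>m. \<Sum>b\<le>m - a. ennreal (P A1 a * (P A2 b * V (m - a - b))))"
    using V_nonneg by (simp add: P_def sum_distrib_left ennreal_mult')
  also have "\<dots> = ennreal (\<Sum>a\<le>m. P A1 a * (\<Sum>b\<le>m - a. P A2 b * V (m - a - b)))"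
    unfolding sum_distrib_left using V_nonneg
    by (intro ennreal_double_sum[symmetric] mult_nonneg_nonneg) (auto simp: P_def)
  finally show ?thesis .
qed

text \<open>\<open>loss_prob\<close> vanishes at negative arguments, so the infinite sum lives on
  the finite triangle a + b \<le> m, where truncated subtraction on \<open>nat\<close> is
  exact.\<close>

lemma shifted_loss_prob_eq_sum:
  "shifted_loss_prob \<alpha>' (int m) A B = (\<Sum>a\<le>m. prob {\<omega> \<in> space M. Exposure A \<omega> = a} *
     (\<Sum>b\<le>m - a. prob {\<omega> \<in> space M. Exposure B \<omega> = b} * pmf (loss_law \<alpha>') (m - a - b)))"
proof -
  let ?P = "\<lambda>A a. prob {\<omega> \<in> space M. Exposure A \<omega> = a}"
  let ?J = "SIGMA a:{..m}. {..m - a}"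
  have "shifted_loss_prob \<alpha>' (int m) A B
    = (\<Sum>\<^sub>\<infinity>(a, b)\<in>?J. ?P A a * ?P B b * loss_prob \<alpha>' (int m - int a - int b))"
    unfolding shifted_loss_prob_def
    by (rule infsum_cong_neutral) (auto simp: loss_prob_def split: if_splits)
  also have "\<dots> = (\<Sum>(a, b)\<in>?J. ?P A a * ?P B b * loss_prob \<alpha>' (int m - int a - int b))"
    by (rule infsum_finite) auto
  also have "\<dots> = (\<Sum>(a, b)\<in>?J. ?P A a * ?P B b * pmf (loss_law \<alpha>') (m - a - b))"
    by (intro sum.cong refl) (auto simp: loss_prob_def nat_diff_distrib' simp flip: of_nat_add)
  also have "\<dots> = (\<Sum>a\<le>m. \<Sum>b\<le>m - a. ?P A a * ?P B b * pmf (loss_law \<alpha>') (m - a - b))"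
    by (rule sum.Sigma[symmetric]) auto
  finally show ?thesis
    by (simp add: sum_distrib_left mult.assoc)
qed

text \<open>The product in \<open>loss_gf\<close> runs over 1..N. This matters because
  \<open>pair_exponents\<close> with an index 0 also alters entry 0 of the parameter vector.\<close>

lemma shifted_loss_prob_cong:
  assumes "\<And>k. k \<in> {1..N} \<Longrightarrow> \<alpha>' k = \<alpha>'' k"
  shows "shifted_loss_prob \<alpha>' = shifted_loss_prob \<alpha>''"
proof -
  have "loss_gf \<alpha>' z = loss_gf \<alpha>'' z" for z
    unfolding loss_gf_def using assms by (intro arg_cong2[where f="(*)"] prod.cong refl) auto
  hence "loss_law \<alpha>' = loss_law \<alpha>''"
    by (simp add: loss_law_def)
  thus ?thesis
    by (intro ext) (simp only: shifted_loss_prob_def loss_prob_def)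
qed

lemma cond_expectation_loss_D_D:
  assumes A1: "A1 \<in> Obl" and A2: "A2 \<in> Obl" and distinct: "A1 \<noteq> A2"
    and pos: "loss_prob \<alpha> x > 0"
  shows "cond_expectation_loss (\<lambda>\<omega>. real (D A1 \<omega>) * real (D A2 \<omega>)) x
    = (\<Sum>i=0..N. \<Sum>j=0..N. pair_coeff A1 A2 i j *
        shifted_loss_prob (\<lambda>k. \<alpha> k + real (pair_exponents i j k)) x A1 A2) / loss_prob \<alpha> x"
proof -
  have "0 \<le> x"
    using pos by (auto simp: loss_prob_def split: if_splits)
  then obtain m where x: "x = int m"
    using nonneg_int_cases by blast
  let ?E = "{\<omega> \<in> space M. loss \<omega> = m}"
  let ?f = "\<lambda>\<omega>. real (D A1 \<omega>) * real (D A2 \<omega>)"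
  let ?P = "\<lambda>A a. prob {\<omega> \<in> space M. Exposure A \<omega> = a}"
  define V where "V = (\<lambda>m. \<Sum>i=0..N. \<Sum>j=0..N. pair_coeff A1 A2 i j * pmf (pair_law i j) m)"
  define T where "T = (\<Sum>a\<le>m. ?P A1 a * (\<Sum>b\<le>m - a. ?P A2 b * V (m - a - b)))"
  have f [measurable]: "?f \<in> borel_measurable M"
    using A1 A2 by (intro borel_measurable_times measurable_compose[OF D_measurable]) auto
  have E [measurable]: "?E \<in> sets M"
    by measurable
  have V_nonneg: "0 \<le> V m" for m
    unfolding V_def using pair_coeff_nonneg[OF A1 A2] by (intro sum_nonneg mult_nonneg_nonneg) auto
  have T_nonneg: "0 \<le> T"
    unfolding T_def using V_nonneg by (intro sum_nonneg mult_nonneg_nonneg) auto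
  have pmf_pos: "0 < pmf (loss_law \<alpha>) m"
    using pos by (simp add: x loss_prob_def)
  have "cond_expectation_loss ?f x = (\<integral>\<omega>. ?f \<omega> \<partial>uniform_measure M ?E)"
    by (simp add: cond_expectation_loss_def x)
  also have "\<dots> = enn2real (\<integral>\<^sup>+\<omega>. ennreal (?f \<omega>) \<partial>uniform_measure M ?E)"
    by (rule integral_eq_nn_integral) auto
  also have "(\<integral>\<^sup>+\<omega>. ennreal (?f \<omega>) \<partial>uniform_measure M ?E)
      = (\<integral>\<^sup>+\<omega>. ennreal (?f \<omega>) * indicator ?E \<omega> \<partial>M) / emeasure M ?E"
    by (rule nn_integral_uniform_measure) measurable
  also have "(\<integral>\<^sup>+\<omega>. ennreal (?f \<omega>) * indicator ?E \<omega> \<partial>M)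
      = (\<integral>\<^sup>+\<omega>. ennreal (?f \<omega>) * indicator {\<omega>. loss \<omega> = m} \<omega> \<partial>M)"
    by (intro nn_integral_cong) (auto split: split_indicator)
  also have "\<dots> = ennreal T"
    unfolding T_def V_def by (rule nn_integral_D_D_loss_eq[OF A1 A2 distinct])
  also have "emeasure M ?E = ennreal (pmf (loss_law \<alpha>) m)"
    using A1 by (intro emeasure_loss_eq) auto
  also have "enn2real (ennreal T / ennreal (pmf (loss_law \<alpha>) m)) = T / loss_prob \<alpha> x"
    using T_nonneg pmf_pos by (simp add: divide_ennreal x loss_prob_def)
  also have "T = (\<Sum>i=0..N. \<Sum>j=0..N. pair_coeff A1 A2 i j *
        shifted_loss_prob (\<lambda>k. \<alpha> k + real (pair_exponents i j k)) x A1 A2)"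
  proof -
    \<comment> \<open>The sums over exposures and over sectors are interchanged pairwise until those
      over sectors stand outside.\<close>
    let ?t = "\<lambda>i j a b. pair_coeff A1 A2 i j * (?P A1 a * (?P A2 b * pmf (pair_law i j) (m - a - b)))"
    have "T = (\<Sum>a\<le>m. \<Sum>b\<le>m - a. \<Sum>i=0..N. \<Sum>j=0..N. ?t i j a b)"
      unfolding T_def V_def by (simp add: sum_distrib_left mult_ac)
    also have "\<dots> = (\<Sum>a\<le>m. \<Sum>i=0..N. \<Sum>b\<le>m - a. \<Sum>j=0..N. ?t i j a b)"
      by (intro sum.cong refl sum.swap)
    also have "\<dots> = (\<Sum>i=0..N. \<Sum>a\<le>m. \<Sum>b\<le>m - a. \<Sum>j=0..N. ?t i j a b)"
      by (rule sum.swap)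
    also have "\<dots> = (\<Sum>i=0..N. \<Sum>a\<le>m. \<Sum>j=0..N. \<Sum>b\<le>m - a. ?t i j a b)"
      by (intro sum.cong refl sum.swap)
    also have "\<dots> = (\<Sum>i=0..N. \<Sum>j=0..N. \<Sum>a\<le>m. \<Sum>b\<le>m - a. ?t i j a b)"
      by (intro sum.cong refl sum.swap)
    finally show ?thesis
      by (simp add: x shifted_loss_prob_eq_sum pair_law_def sum_distrib_left)
  qed
  finally show ?thesis .
qed

end

theorem corollary3p4:
  fixes M :: "'w measure" and Obl :: "'o set" and N :: nat
    and \<alpha> :: "nat \<Rightarrow> real" and p :: "'o \<Rightarrow> real" and w :: "'o \<Rightarrow> nat \<Rightarrow> real"
    and S :: "nat \<Rightarrow> 'w \<Rightarrow> real" and D Exposure :: "'o \<Rightarrow> 'w \<Rightarrow> nat"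
    and Copy :: "'o \<Rightarrow> nat \<Rightarrow> 'w \<Rightarrow> nat"
    and A1 A2 :: 'o and x :: int
  assumes model: "credit_risk_plus M Obl N \<alpha> p w S D Exposure Copy"
    and A1: "A1 \<in> Obl" and A2: "A2 \<in> Obl" and distinct: "A1 \<noteq> A2"
    and pos: "credit_risk_plus.loss_prob M Obl N \<alpha> p w Exposure \<alpha> x > 0"
  shows
    "let P = credit_risk_plus.loss_prob M Obl N \<alpha> p w Exposure;
         P' = (\<lambda>\<alpha>'. credit_risk_plus.shifted_loss_prob M Obl N \<alpha> p w Exposure \<alpha>' x A1 A2);
         e = unit_vec
     in credit_risk_plus.cond_expectation_loss M Obl D Copy (\<lambda>\<omega>. real (D A1 \<omega>) * real (D A2 \<omega>)) x =
        p A1 * p A2 / P \<alpha> x *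
          (w A1 0 * w A2 0 * P' \<alpha>
           + (\<Sum>j=1..N. (w A1 0 * w A2 j + w A1 j * w A2 0) * P' (\<lambda>k. \<alpha> k + e j k))
           + (\<Sum>j=1..N. w A1 j * w A2 j * ((\<alpha> j + 1) / \<alpha> j) * P' (\<lambda>k. \<alpha> k + 2 * e j k))
           + (\<Sum>i=1..N. \<Sum>j\<in>{1..N} - {i}. w A1 i * w A2 j * P' (\<lambda>k. \<alpha> k + e i k + e j k)))"
proof -
  interpret credit_risk_plus M Obl N \<alpha> p w S D Exposure Copy
    by (rule model)
  let ?Q = "\<lambda>\<alpha>'. shifted_loss_prob \<alpha>' x A1 A2"
  \<comment> \<open>The contribution of the sector pair (i, j) without its weights; it is evaluated
    below for each pattern of indices.\<close>
  define G where "G i j = moment (pair_exponents i j) * ?Q (\<lambda>k. \<alpha> k + real (pair_exponents i j k))" for i j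
  have G00: "G 0 0 = ?Q \<alpha>"
    unfolding G_def moment_pair_exponents
    by (subst shifted_loss_prob_cong[of _ \<alpha>]) (auto simp: pair_exponents_def)
  have G0j: "G 0 j = ?Q (\<lambda>k. \<alpha> k + unit_vec j k)" and Gj0: "G j 0 = ?Q (\<lambda>k. \<alpha> k + unit_vec j k)"
    if "j \<in> {1..N}" for j
    using that unfolding G_def moment_pair_exponents
    by (subst shifted_loss_prob_cong[of _ "\<lambda>k. \<alpha> k + unit_vec j k"];
        auto simp: pair_exponents_def unit_vec_def)+
  have Gjj: "G j j = (\<alpha> j + 1) / \<alpha> j * ?Q (\<lambda>k. \<alpha> k + 2 * unit_vec j k)" if "j \<in> {1..N}" for j
    using that unfolding G_def moment_pair_exponents
    by (subst shifted_loss_prob_cong[of _ "\<lambda>k. \<alpha> k + 2 * unit_vec j k"])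
       (auto simp: pair_exponents_def unit_vec_def)
  have Gij: "G i j = ?Q (\<lambda>k. \<alpha> k + unit_vec i k + unit_vec j k)" if "i \<noteq> j" for i j
    using that unfolding G_def moment_pair_exponents
    by (subst shifted_loss_prob_cong[of _ "\<lambda>k. \<alpha> k + unit_vec i k + unit_vec j k"])
       (auto simp: pair_exponents_def unit_vec_def)
  let ?g = "\<lambda>i j. w A1 i * w A2 j * G i j"
  have split: "(\<Sum>i=0..N. f i) = f 0 + (\<Sum>i=1..N. f i)" for f :: "nat \<Rightarrow> real"
    by (simp add: sum.atLeast_Suc_atMost)
  \<comment> \<open>The index square splits into the corner (0, 0), the two edges with exactly one
    index 0, merged into one sum, and the inner square, which is then divided into diagonal and
    off-diagonal pairs.\<close>
  have "(\<Sum>i=0..N. \<Sum>j=0..N. ?g i j)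
    = ?g 0 0 + (\<Sum>j=1..N. ?g 0 j + ?g j 0) + (\<Sum>i=1..N. \<Sum>j=1..N. ?g i j)"
    unfolding split by (simp add: sum.distrib)
  also have "(\<Sum>i=1..N. \<Sum>j=1..N. ?g i j) = (\<Sum>i=1..N. ?g i i + (\<Sum>j\<in>{1..N} - {i}. ?g i j))"
    by (intro sum.cong refl sum.remove) auto
  also have "\<dots> = (\<Sum>i=1..N. ?g i i) + (\<Sum>i=1..N. \<Sum>j\<in>{1..N} - {i}. ?g i j)"
    by (rule sum.distrib)
  also have "(\<Sum>j=1..N. ?g 0 j + ?g j 0)
      = (\<Sum>j=1..N. (w A1 0 * w A2 j + w A1 j * w A2 0) * ?Q (\<lambda>k. \<alpha> k + unit_vec j k))"
    by (intro sum.cong refl) (simp add: G0j Gj0 algebra_simps)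
  also have "(\<Sum>i=1..N. ?g i i)
      = (\<Sum>j=1..N. w A1 j * w A2 j * ((\<alpha> j + 1) / \<alpha> j) * ?Q (\<lambda>k. \<alpha> k + 2 * unit_vec j k))"
    by (intro sum.cong refl) (simp add: Gjj)
  also have "(\<Sum>i=1..N. \<Sum>j\<in>{1..N} - {i}. ?g i j)
      = (\<Sum>i=1..N. \<Sum>j\<in>{1..N} - {i}. w A1 i * w A2 j * ?Q (\<lambda>k. \<alpha> k + unit_vec i k + unit_vec j k))"
    by (intro sum.cong refl) (simp add: Gij)
  finally have *: "(\<Sum>i=0..N. \<Sum>j=0..N. ?g i j) = w A1 0 * w A2 0 * ?Q \<alpha>
      + (\<Sum>j=1..N. (w A1 0 * w A2 j + w A1 j * w A2 0) * ?Q (\<lambda>k. \<alpha> k + unit_vec j k))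
      + ((\<Sum>j=1..N. w A1 j * w A2 j * ((\<alpha> j + 1) / \<alpha> j) * ?Q (\<lambda>k. \<alpha> k + 2 * unit_vec j k))
      + (\<Sum>i=1..N. \<Sum>j\<in>{1..N} - {i}. w A1 i * w A2 j * ?Q (\<lambda>k. \<alpha> k + unit_vec i k + unit_vec j k)))"
    unfolding G00 .
  have "cond_expectation_loss (\<lambda>\<omega>. real (D A1 \<omega>) * real (D A2 \<omega>)) x
    = p A1 * p A2 / loss_prob \<alpha> x * (\<Sum>i=0..N. \<Sum>j=0..N. ?g i j)"
    unfolding cond_expectation_loss_D_D[OF A1 A2 distinct pos] G_def pair_coeff_def
    by (simp add: sum_distrib_left sum_divide_distrib mult.assoc)
  thus ?thesis
    unfolding Let_def * by (simp only: add.assoc)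
qed

end
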